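(* For every $k\in\mathcal{M}(W)$, the subspace $\mathbf{Q}_{2k+1}(W)\subset\mathbf{k}[V_{\rm reg}]\otimes\mathbf{k}[W]$ is stable under the operators $$\nabla_\alpha\Bigl[\sum_{w\in W}f_w\otimes w\Bigr]=\sum_{w\in W}\frac{f_w-s_\alpha f_{s_\alpha w}}{\alpha}\otimes w\qquad(\alpha\in\mathcal{A}),$$ and hence carries a left module structure over the Demazure (nil-Hecke) algebra $\mathfrak{N}(W)$ of $W$ extending the natural $\mathbf{k}[V]$-module structure on $\mathbf{Q}_{2k+1}(W)$ defined via the inclusion $\mathbf{k}[V]\hookrightarrow\mathbf{Q}_{2k+1}(W)$, $f\mapsto\sum_{w\in W}f\otimes w$.
   Context: Let $\mathbf{k}$ be a field of characteristic zero, $W$ a finite Coxeter group and $V$ a finite-dimensional $\mathbf{k}$-vector space carrying a reflection representation of $W$. Let $\mathcal{A}$ be the set of reflection hyperplanes; for each fix a linear form $\alpha\in V^*$ with $H_\alpha=\mathrm{Ker}(\alpha)$ (we write $\alpha\in\mathcal{A}$), and let $s_\alpha\in W$ be the corresponding reflection. $\mathcal{M}(W)$ is the set of $W$-invariant functions $k:\mathcal{A}\to\mathbb{Z}_{\ge0}$, $\alpha\mapsto k_\alpha$; $2k+1$ is the function $\alpha\mapsto2k_\alpha+1$. $\mathbf{Q}_m(W)=\{\sum_{w\in W}p_w\otimes w\in\mathbf{k}[V]\otimes\mathbf{k}[W]: p_w\equiv p_{s_\alpha w}\bmod\langle\alpha\rangle^{m_\alpha}\ \forall\,\alpha\in\mathcal{A},\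 w\in W\}$ (quasi-covariants). $V_{\rm reg}=V\setminus\bigcup_{\alpha\in\mathcal{A}}H_\alpha$, and $\mathbf{k}[V_{\rm reg}]\rtimes W$ is the crossed product. The Demazure (nil-Hecke) algebra $\mathfrak{N}(W)$ is the subalgebra of $\mathbf{k}[V_{\rm reg}]\rtimes W$ generated by $\mathbf{k}[V]$, $W$ and the divided difference elements $\nabla_\alpha=\frac1\alpha(1-s_\alpha)$, $\alpha\in\mathcal{A}$. The algebra $\mathbf{k}[V_{\rm reg}]\rtimes W$ (hence $\mathfrak{N}(W)$) acts on $\mathbf{k}[V_{\rm reg}]\otimes\mathbf{k}[W]$ by $g(f\otimes w)=gf\otimes w$ for $g\in\mathbf{k}[V_{\rm reg}]$ and $s(f\otimes w)=s(f)\otimes sw$ for $s\in W$; the element $\nabla_\alpha$ then acts by the displayed formula. *)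

theory Defs
  imports "HOL-Algebra.Algebra"
begin

section \<open>Finite Coxeter groups and reflection representations\<close>

text \<open>
  \<open>(G, S)\<close> is a Coxeter system in the sense of Bourbaki: \<open>G\<close> is generated by the set \<open>S\<close> of elements of
  order two and presented by the relations \<open>(s t)^m = 1\<close>, where \<open>m\<close> is the order of \<open>s t\<close>.
  The relators with \<open>s = t\<close> are the words \<open>[s, s]\<close>, so words without formal inverses suffice.  An
  infinite order is 0 in the library, and the corresponding relator is the empty word.
\<close>

definition coxeter_relator :: "('g, 'c) monoid_scheme \<Rightarrow> 'g \<Rightarrow> 'g \<Rightarrow> 'g list" where
  "coxeter_relator G s t = concat (replicate (group.ord G (s \<otimes>\<^bsub>G\<^esub> t)) [s, t])"

inductive coxeter_step :: "('g, 'c) monoid_scheme \<Rightarrow> 'g set \<Rightarrow> 'g list \<Rightarrow> 'g list \<Rightarrow> bool"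
  for G S where
  "\<lbrakk>s \<in> S; t \<in> S; xs \<in> lists S; ys \<in> lists S\<rbrakk>
     \<Longrightarrow> coxeter_step G S (xs @ coxeter_relator G s t @ ys) (xs @ ys)"

definition coxeter_system :: "('g, 'c) monoid_scheme \<Rightarrow> 'g set \<Rightarrow> bool" where
  "coxeter_system G S \<longleftrightarrow>
     group G \<and> S \<subseteq> carrier G \<and> generate G S = carrier G \<and>
     (\<forall>s\<in>S. group.ord G s = 2) \<and>
     (\<forall>xs\<in>lists S. foldr (\<otimes>\<^bsub>G\<^esub>) xs \<one>\<^bsub>G\<^esub> = \<one>\<^bsub>G\<^esub> \<longrightarrow> equivclp (coxeter_step G S) xs [])"

definition is_reflection :: "('k::field \<Rightarrow> 'v::ab_group_add \<Rightarrow> 'v) \<Rightarrow> ('v \<Rightarrow> 'v) \<Rightarrow> bool" where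
  "is_reflection scale T \<longleftrightarrow>
     Vector_Spaces.linear scale scale T \<and> T \<circ> T = id \<and> T \<noteq> id \<and>
     vector_space.dim scale {v. T v = v} + 1 = vector_space.dim scale (UNIV :: 'v set)"

text \<open>
  The vector space \<open>V\<close> is the type \<open>'v\<close> with the scalar multiplication \<open>scale\<close>; the reflection
  representation is the faithful linear action \<open>\<rho>\<close>.
\<close>

locale coxeter_reflection_rep =
  finite_dimensional_vector_space scale Basis + faithful_action W "UNIV :: 'v set" \<rho>
  for scale :: "'k::field_char_0 \<Rightarrow> 'v::ab_group_add \<Rightarrow> 'v"
    and Basis :: "'v set"
    and W :: "('g, 'c) monoid_scheme"
    and \<rho> :: "'g \<Rightarrow> 'v \<Rightarrow> 'v" +
  fixes S :: "'g set"
  assumes finite_W: "finite (carrier W)"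
    and coxeter: "coxeter_system W S"
    and linear_rep: "w \<in> carrier W \<Longrightarrow> Vector_Spaces.linear scale scale (\<rho> w)"
    and simple_reflection: "s \<in> S \<Longrightarrow> is_reflection scale (\<rho> s)"

definition fixed_space :: "('g \<Rightarrow> 'v \<Rightarrow> 'v) \<Rightarrow> 'g \<Rightarrow> 'v set" where
  "fixed_space \<rho> w = {v. \<rho> w v = v}"

definition reflections ::
  "('k::field \<Rightarrow> 'v::ab_group_add \<Rightarrow> 'v) \<Rightarrow> ('g, 'c) monoid_scheme \<Rightarrow> ('g \<Rightarrow> 'v \<Rightarrow> 'v) \<Rightarrow> 'g set" where
  "reflections scale W \<rho> = {w \<in> carrier W. is_reflection scale (\<rho> w)}"

definition arrangement ::
  "('k::field \<Rightarrow> 'v::ab_group_add \<Rightarrow> 'v) \<Rightarrow> ('g, 'c) monoid_scheme \<Rightarrow> ('g \<Rightarrow> 'v \<Rightarrow> 'v) \<Rightarrow> 'v set set" where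
  "arrangement scale W \<rho> = fixed_space \<rho> ` reflections scale W \<rho>"

text \<open>
  Hyperplanes, rather than the linear forms chosen for them, serve as indices: \<open>\<alpha> H\<close> is the form
  chosen for \<open>H\<close>, and \<open>hyper_refl scale W \<rho> H\<close> is the corresponding reflection in \<open>W\<close> (unique by
  \<open>reflection_unique\<close> below).
\<close>

definition hyper_refl ::
  "('k::field \<Rightarrow> 'v::ab_group_add \<Rightarrow> 'v) \<Rightarrow> ('g, 'c) monoid_scheme \<Rightarrow> ('g \<Rightarrow> 'v \<Rightarrow> 'v) \<Rightarrow> 'v set \<Rightarrow> 'g" where
  "hyper_refl scale W \<rho> H = (THE s. s \<in> reflections scale W \<rho> \<and> fixed_space \<rho> s = H)"

lemma (in coxeter_reflection_rep) reflection_unique: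
  assumes "H \<in> arrangement scale W \<rho>"
  shows "\<exists>!s. s \<in> reflections scale W \<rho> \<and> fixed_space \<rho> s = H"
proof -
  interpret G: group W
    using coxeter by (simp add: coxeter_system_def)
  have hom: "\<rho> (x \<otimes>\<^bsub>W\<^esub> y) = \<rho> x \<circ> \<rho> y" if "x \<in> carrier W" "y \<in> carrier W" for x y
    using composition_rule[of _ x y] that by (auto simp: fun_eq_iff)
  have one: "\<rho> \<one>\<^bsub>W\<^esub> v = v" for v
    using id_eq_one by (metis UNIV_I restrict_apply')
  have "s = t" if s: "s \<in> reflections scale W \<rho>" "fixed_space \<rho> s = H"
    and t: "t \<in> reflections scale W \<rho>" "fixed_space \<rho> t = H" for s t
  proof -
    have cs: "s \<in> carrier W" and ct: "t \<in> carrier W"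
      using s t by (auto simp: reflections_def)
    interpret f: Vector_Spaces.linear scale scale "\<rho> s"
      using s by (simp add: reflections_def is_reflection_def)
    interpret g: Vector_Spaces.linear scale scale "\<rho> t"
      using t by (simp add: reflections_def is_reflection_def)
    have ff: "\<rho> s (\<rho> s v) = v" and gg: "\<rho> t (\<rho> t v) = v" for v
      using s t by (auto simp: reflections_def is_reflection_def fun_eq_iff)
    have fix_eq: "\<rho> s v = v \<longleftrightarrow> \<rho> t v = v" for v
      using s t by (auto simp: fixed_space_def)
    have "\<rho> s v = \<rho> t v" for v
    proof -
      define u where "u = \<rho> s v - \<rho> t v"
      have "\<rho> s (\<rho> s v + v) = \<rho> s v + v"
        by (simp add: f.add ff add.commute)
      moreover have "\<rho> s (\<rho> t v + v) = \<rho> t v + v"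
        by (simp add: fix_eq g.add gg add.commute)
      moreover have "u = (\<rho> s v + v) - (\<rho> t v + v)"
        by (simp add: u_def)
      ultimately have su: "\<rho> s u = u"
        by (metis f.diff)
      then have tu: "\<rho> t u = u"
        by (simp add: fix_eq)
      have sv: "\<rho> s v = \<rho> t v + u"
        by (simp add: u_def)
      define x where "x = t \<otimes>\<^bsub>W\<^esub> s"
      have cx: "x \<in> carrier W"
        using cs ct by (simp add: x_def)
      have xv: "\<rho> x v = v + u" and xu: "\<rho> x u = u"
        by (simp_all add: x_def hom cs ct sv g.add gg su tu)
      have xadd: "\<rho> x (a + b) = \<rho> x a + \<rho> x b" for a b
        by (simp add: x_def hom cs ct f.add g.add)
      have xn: "\<rho> (x [^]\<^bsub>W\<^esub> n) u = u \<and> \<rho> (x [^]\<^bsub>W\<^esub> n) v = v + scale (of_nat n) u" for n :: nat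
      proof (induction n)
        case 0
        then show ?case by (simp add: one)
      next
        case (Suc n)
        have "\<rho> (x [^]\<^bsub>W\<^esub> Suc n) = \<rho> x \<circ> \<rho> (x [^]\<^bsub>W\<^esub> n)"
          by (metis G.nat_pow_Suc2 G.nat_pow_closed cx hom)
        moreover have "\<rho> x (scale (of_nat n) u) = scale (of_nat n) u"
          by (simp add: x_def hom cs ct f.scale g.scale su tu)
        ultimately show ?case
          using Suc by (simp add: xv xu xadd scale_left_distrib algebra_simps)
      qed
      have "x [^]\<^bsub>W\<^esub> order W = \<one>\<^bsub>W\<^esub>"
        using G.pow_order_eq_1 cx finite_W by blast
      then have "scale (of_nat (order W)) u = 0"
        using xn[of "order W"] one by simp
      moreover have "order W \<noteq> 0"
        using finite_W G.order_gt_0_iff_finite by simp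
      ultimately have "u = 0"
        by simp
      then show ?thesis by (simp add: u_def)
    qed
    then have "\<rho> s = \<rho> t" by blast
    then show ?thesis
      using faithful cs ct by (simp add: inj_on_def)
  qed
  then show ?thesis
    using assms by (auto simp: arrangement_def)
qed

definition hyperplane_forms ::
  "('k::field \<Rightarrow> 'v::ab_group_add \<Rightarrow> 'v) \<Rightarrow> ('g, 'c) monoid_scheme \<Rightarrow> ('g \<Rightarrow> 'v \<Rightarrow> 'v)
     \<Rightarrow> ('v set \<Rightarrow> 'v \<Rightarrow> 'k) \<Rightarrow> bool" where
  "hyperplane_forms scale W \<rho> \<alpha> \<longleftrightarrow>
     (\<forall>H \<in> arrangement scale W \<rho>. Vector_Spaces.linear scale (*) (\<alpha> H) \<and> {v. \<alpha> H v = 0} = H)"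

definition multiplicities ::
  "('k::field \<Rightarrow> 'v::ab_group_add \<Rightarrow> 'v) \<Rightarrow> ('g, 'c) monoid_scheme \<Rightarrow> ('g \<Rightarrow> 'v \<Rightarrow> 'v)
     \<Rightarrow> ('v set \<Rightarrow> nat) set" where
  "multiplicities scale W \<rho> =
     {k. \<forall>H \<in> arrangement scale W \<rho>. \<forall>w \<in> carrier W. k (\<rho> w ` H) = k H}"

section \<open>Regular functions on \<open>V\<close> and \<open>V_reg\<close>\<close>

text \<open>
  The ground field is infinite, so \<open>k[V]\<close> is the algebra of polynomial functions on \<open>V\<close> and its
  localisation \<open>k[V_reg]\<close> is an algebra of functions on \<open>V_reg\<close>.  Functions on \<open>V_reg\<close> are
  represented by their extension by zero to \<open>V\<close>.
\<close>

inductive_set polyfuns :: "('k::field \<Rightarrow> 'v::ab_group_add \<Rightarrow> 'v) \<Rightarrow> ('v \<Rightarrow> 'k) set"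
  for scale where
  const: "(\<lambda>_. c) \<in> polyfuns scale"
| form: "Vector_Spaces.linear scale (*) f \<Longrightarrow> f \<in> polyfuns scale"
| add: "f \<in> polyfuns scale \<Longrightarrow> g \<in> polyfuns scale \<Longrightarrow> (\<lambda>v. f v + g v) \<in> polyfuns scale"
| mult: "f \<in> polyfuns scale \<Longrightarrow> g \<in> polyfuns scale \<Longrightarrow> (\<lambda>v. f v * g v) \<in> polyfuns scale"

definition polyfun_ring :: "('k::field \<Rightarrow> 'v::ab_group_add \<Rightarrow> 'v) \<Rightarrow> ('v \<Rightarrow> 'k) ring" where
  "polyfun_ring scale =
     \<lparr>carrier = polyfuns scale,
      monoid.mult = (\<lambda>f g v. f v * g v), one = (\<lambda>_. 1),
      ring.zero = (\<lambda>_. 0), ring.add = (\<lambda>f g v. f v + g v)\<rparr>"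

definition vreg ::
  "('k::field \<Rightarrow> 'v::ab_group_add \<Rightarrow> 'v) \<Rightarrow> ('g, 'c) monoid_scheme \<Rightarrow> ('g \<Rightarrow> 'v \<Rightarrow> 'v) \<Rightarrow> 'v set" where
  "vreg scale W \<rho> = UNIV - \<Union>(arrangement scale W \<rho>)"

definition res ::
  "('k::field \<Rightarrow> 'v::ab_group_add \<Rightarrow> 'v) \<Rightarrow> ('g, 'c) monoid_scheme \<Rightarrow> ('g \<Rightarrow> 'v \<Rightarrow> 'v)
     \<Rightarrow> ('v \<Rightarrow> 'k) \<Rightarrow> 'v \<Rightarrow> 'k" where
  "res scale W \<rho> f = (\<lambda>v. if v \<in> vreg scale W \<rho> then f v else 0)"

definition regfuns ::
  "('k::field \<Rightarrow> 'v::ab_group_add \<Rightarrow> 'v) \<Rightarrow> ('g, 'c) monoid_scheme \<Rightarrow> ('g \<Rightarrow> 'v \<Rightarrow> 'v)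
     \<Rightarrow> ('v set \<Rightarrow> 'v \<Rightarrow> 'k) \<Rightarrow> ('v \<Rightarrow> 'k) set" where
  "regfuns scale W \<rho> \<alpha> =
     {res scale W \<rho> (\<lambda>v. p v / (\<Prod>H \<in> arrangement scale W \<rho>. \<alpha> H v) ^ n) |p n. p \<in> polyfuns scale}"

definition fun_act ::
  "('g, 'c) monoid_scheme \<Rightarrow> ('g \<Rightarrow> 'v \<Rightarrow> 'v) \<Rightarrow> 'g \<Rightarrow> ('v \<Rightarrow> 'k) \<Rightarrow> 'v \<Rightarrow> 'k" where
  "fun_act W \<rho> w f = (\<lambda>v. f (\<rho> (inv\<^bsub>W\<^esub> w) v))"

section \<open>The crossed product, its action on \<open>k[V_reg] \<otimes> k[W]\<close>, and the Demazure algebra\<close>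

text \<open>
  Both \<open>k[V_reg] \<otimes> k[W]\<close> and the underlying space of \<open>k[V_reg] \<rtimes> W\<close> are the space of families
  \<open>(f_w)\<close> of elements of \<open>k[V_reg]\<close> indexed by \<open>W\<close>, standing for the sums of \<open>f_w \<otimes> w\<close> and of
  \<open>f_w w\<close>.  A family is a function on the type \<open>'g\<close> that is zero off the carrier of \<open>W\<close>.
\<close>

definition families :: "('g, 'c) monoid_scheme \<Rightarrow> ('g \<Rightarrow> 'v \<Rightarrow> 'k::zero) \<Rightarrow> 'g \<Rightarrow> 'v \<Rightarrow> 'k" where
  "families W f = (\<lambda>w. if w \<in> carrier W then f w else (\<lambda>_. 0))"

definition tensor_space ::
  "('k::field \<Rightarrow> 'v::ab_group_add \<Rightarrow> 'v) \<Rightarrow> ('g, 'c) monoid_scheme \<Rightarrow> ('g \<Rightarrow> 'v \<Rightarrow> 'v)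
     \<Rightarrow> ('v set \<Rightarrow> 'v \<Rightarrow> 'k) \<Rightarrow> ('g \<Rightarrow> 'v \<Rightarrow> 'k) set" where
  "tensor_space scale W \<rho> \<alpha> =
     {families W f |f. \<forall>w \<in> carrier W. f w \<in> regfuns scale W \<rho> \<alpha>}"

definition single :: "'g \<Rightarrow> ('v \<Rightarrow> 'k::zero) \<Rightarrow> 'g \<Rightarrow> 'v \<Rightarrow> 'k" where
  "single w f = (\<lambda>u. if u = w then f else (\<lambda>_. 0))"

text \<open>
  The biadditive extension of \<open>(g w) (f \<otimes> u) = g w(f) \<otimes> w u\<close>.  The product of the crossed product,
  \<open>(g w) (f u) = g w(f) w u\<close>, is given by the same formula.
\<close>

definition twisted_act ::
  "('g, 'c) monoid_scheme \<Rightarrow> ('g \<Rightarrow> 'v \<Rightarrow> 'v)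
     \<Rightarrow> ('g \<Rightarrow> 'v \<Rightarrow> 'k::field) \<Rightarrow> ('g \<Rightarrow> 'v \<Rightarrow> 'k) \<Rightarrow> 'g \<Rightarrow> 'v \<Rightarrow> 'k" where
  "twisted_act W \<rho> A F =
     (\<lambda>x v. \<Sum>w\<in>carrier W. \<Sum>u\<in>carrier W.
        if w \<otimes>\<^bsub>W\<^esub> u = x then A w v * fun_act W \<rho> w (F u) v else 0)"

definition crossed_product ::
  "('k::field \<Rightarrow> 'v::ab_group_add \<Rightarrow> 'v) \<Rightarrow> ('g, 'c) monoid_scheme \<Rightarrow> ('g \<Rightarrow> 'v \<Rightarrow> 'v)
     \<Rightarrow> ('v set \<Rightarrow> 'v \<Rightarrow> 'k) \<Rightarrow> ('g \<Rightarrow> 'v \<Rightarrow> 'k) ring" where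
  "crossed_product scale W \<rho> \<alpha> =
     \<lparr>carrier = tensor_space scale W \<rho> \<alpha>,
      monoid.mult = twisted_act W \<rho>,
      one = single \<one>\<^bsub>W\<^esub> (res scale W \<rho> (\<lambda>_. 1)),
      ring.zero = (\<lambda>_ _. 0),
      ring.add = (\<lambda>A B w v. A w v + B w v)\<rparr>"

definition fun_elt ::
  "('k::field \<Rightarrow> 'v::ab_group_add \<Rightarrow> 'v) \<Rightarrow> ('g, 'c) monoid_scheme \<Rightarrow> ('g \<Rightarrow> 'v \<Rightarrow> 'v)
     \<Rightarrow> ('v \<Rightarrow> 'k) \<Rightarrow> 'g \<Rightarrow> 'v \<Rightarrow> 'k" where
  "fun_elt scale W \<rho> f = single \<one>\<^bsub>W\<^esub> (res scale W \<rho> f)"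

definition grp_elt ::
  "('k::field \<Rightarrow> 'v::ab_group_add \<Rightarrow> 'v) \<Rightarrow> ('g, 'c) monoid_scheme \<Rightarrow> ('g \<Rightarrow> 'v \<Rightarrow> 'v)
     \<Rightarrow> 'g \<Rightarrow> 'g \<Rightarrow> 'v \<Rightarrow> 'k" where
  "grp_elt scale W \<rho> w = single w (res scale W \<rho> (\<lambda>_. 1))"

definition nabla_elt ::
  "('k::field \<Rightarrow> 'v::ab_group_add \<Rightarrow> 'v) \<Rightarrow> ('g, 'c) monoid_scheme \<Rightarrow> ('g \<Rightarrow> 'v \<Rightarrow> 'v)
     \<Rightarrow> ('v set \<Rightarrow> 'v \<Rightarrow> 'k) \<Rightarrow> 'v set \<Rightarrow> 'g \<Rightarrow> 'v \<Rightarrow> 'k" where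
  "nabla_elt scale W \<rho> \<alpha> H =
     (let R = crossed_product scale W \<rho> \<alpha>
      in fun_elt scale W \<rho> (\<lambda>v. 1 / \<alpha> H v) \<otimes>\<^bsub>R\<^esub>
           (\<one>\<^bsub>R\<^esub> \<ominus>\<^bsub>R\<^esub> grp_elt scale W \<rho> (hyper_refl scale W \<rho> H)))"

text \<open>
  The generators contain the constants, so the subring they generate is the generated subalgebra.
\<close>

definition demazure_algebra ::
  "('k::field \<Rightarrow> 'v::ab_group_add \<Rightarrow> 'v) \<Rightarrow> ('g, 'c) monoid_scheme \<Rightarrow> ('g \<Rightarrow> 'v \<Rightarrow> 'v)
     \<Rightarrow> ('v set \<Rightarrow> 'v \<Rightarrow> 'k) \<Rightarrow> ('g \<Rightarrow> 'v \<Rightarrow> 'k) ring" where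
  "demazure_algebra scale W \<rho> \<alpha> =
     (crossed_product scale W \<rho> \<alpha>)
       \<lparr>carrier := generate_ring (crossed_product scale W \<rho> \<alpha>)
          (fun_elt scale W \<rho> ` polyfuns scale \<union>
           grp_elt scale W \<rho> ` carrier W \<union>
           nabla_elt scale W \<rho> \<alpha> ` arrangement scale W \<rho>)\<rparr>"

definition nabla_op ::
  "('k::field \<Rightarrow> 'v::ab_group_add \<Rightarrow> 'v) \<Rightarrow> ('g, 'c) monoid_scheme \<Rightarrow> ('g \<Rightarrow> 'v \<Rightarrow> 'v)
     \<Rightarrow> ('v set \<Rightarrow> 'v \<Rightarrow> 'k) \<Rightarrow> 'v set \<Rightarrow> ('g \<Rightarrow> 'v \<Rightarrow> 'k) \<Rightarrow> 'g \<Rightarrow> 'v \<Rightarrow> 'k" where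
  "nabla_op scale W \<rho> \<alpha> H F =
     (let s = hyper_refl scale W \<rho> H
      in families W (\<lambda>w. res scale W \<rho>
           (\<lambda>v. (F w v - fun_act W \<rho> s (F (s \<otimes>\<^bsub>W\<^esub> w)) v) / \<alpha> H v)))"

section \<open>Quasi-covariants\<close>

text \<open>The congruence modulo the \<open>m H\<close>-th power of the principal ideal of \<open>\<alpha> H\<close> is taken in \<open>k[V]\<close>.\<close>

definition quasi_covariants ::
  "('k::field \<Rightarrow> 'v::ab_group_add \<Rightarrow> 'v) \<Rightarrow> ('g, 'c) monoid_scheme \<Rightarrow> ('g \<Rightarrow> 'v \<Rightarrow> 'v)
     \<Rightarrow> ('v set \<Rightarrow> 'v \<Rightarrow> 'k) \<Rightarrow> ('v set \<Rightarrow> nat) \<Rightarrow> ('g \<Rightarrow> 'v \<Rightarrow> 'k) set" where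
  "quasi_covariants scale W \<rho> \<alpha> m =
     {families W (\<lambda>w. res scale W \<rho> (p w)) |p.
        (\<forall>w \<in> carrier W. p w \<in> polyfuns scale) \<and>
        (\<forall>H \<in> arrangement scale W \<rho>. \<forall>w \<in> carrier W. \<exists>q \<in> polyfuns scale.
           \<forall>v. p w v - p (hyper_refl scale W \<rho> H \<otimes>\<^bsub>W\<^esub> w) v = \<alpha> H v ^ m H * q v)}"

text \<open>
  The multiplicative structure is the componentwise product, which makes \<open>poly_incl\<close> a ring
  homomorphism; the scalar multiplication is the action of the crossed product.
\<close>

definition quasi_covariant_module ::
  "('k::field \<Rightarrow> 'v::ab_group_add \<Rightarrow> 'v) \<Rightarrow> ('g, 'c) monoid_scheme \<Rightarrow> ('g \<Rightarrow> 'v \<Rightarrow> 'v)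
     \<Rightarrow> ('v set \<Rightarrow> 'v \<Rightarrow> 'k) \<Rightarrow> ('v set \<Rightarrow> nat) \<Rightarrow> ('g \<Rightarrow> 'v \<Rightarrow> 'k, 'g \<Rightarrow> 'v \<Rightarrow> 'k) module" where
  "quasi_covariant_module scale W \<rho> \<alpha> m =
     \<lparr>carrier = quasi_covariants scale W \<rho> \<alpha> m,
      monoid.mult = (\<lambda>F G w v. F w v * G w v),
      one = families W (\<lambda>_. res scale W \<rho> (\<lambda>_. 1)),
      ring.zero = (\<lambda>_ _. 0),
      ring.add = (\<lambda>F G w v. F w v + G w v),
      smult = twisted_act W \<rho>\<rparr>"

definition poly_incl ::
  "('k::field \<Rightarrow> 'v::ab_group_add \<Rightarrow> 'v) \<Rightarrow> ('g, 'c) monoid_scheme \<Rightarrow> ('g \<Rightarrow> 'v \<Rightarrow> 'v)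
     \<Rightarrow> ('v \<Rightarrow> 'k) \<Rightarrow> 'g \<Rightarrow> 'v \<Rightarrow> 'k" where
  "poly_incl scale W \<rho> f = families W (\<lambda>_. res scale W \<rho> f)"

text \<open>\<open>module\<close> in HOL-Algebra is restricted to commutative rings.\<close>

locale left_module = R?: ring R + M?: abelian_group M
  for R :: "('a, 'm) ring_scheme" (structure) and M :: "('a, 'b, 'n) module_scheme" (structure) +
  assumes smult_closed: "a \<in> carrier R \<Longrightarrow> x \<in> carrier M \<Longrightarrow> a \<odot>\<^bsub>M\<^esub> x \<in> carrier M"
    and smult_l_distr: "\<lbrakk>a \<in> carrier R; b \<in> carrier R; x \<in> carrier M\<rbrakk>
      \<Longrightarrow> (a \<oplus>\<^bsub>R\<^esub> b) \<odot>\<^bsub>M\<^esub> x = a \<odot>\<^bsub>M\<^esub> x \<oplus>\<^bsub>M\<^esub> b \<odot>\<^bsub>M\<^esub> x"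
    and smult_r_distr: "\<lbrakk>a \<in> carrier R; x \<in> carrier M; y \<in> carrier M\<rbrakk>
      \<Longrightarrow> a \<odot>\<^bsub>M\<^esub> (x \<oplus>\<^bsub>M\<^esub> y) = a \<odot>\<^bsub>M\<^esub> x \<oplus>\<^bsub>M\<^esub> a \<odot>\<^bsub>M\<^esub> y"
    and smult_assoc: "\<lbrakk>a \<in> carrier R; b \<in> carrier R; x \<in> carrier M\<rbrakk>
      \<Longrightarrow> (a \<otimes>\<^bsub>R\<^esub> b) \<odot>\<^bsub>M\<^esub> x = a \<odot>\<^bsub>M\<^esub> (b \<odot>\<^bsub>M\<^esub> x)"
    and smult_one: "x \<in> carrier M \<Longrightarrow> \<one>\<^bsub>R\<^esub> \<odot>\<^bsub>M\<^esub> x = x"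

end

theory Submission
  imports Defs "HOL-Computational_Algebra.Polynomial"
begin

text \<open>
  For \<open>s = s_\<alpha>\<close> and a family \<open>p\<close> satisfying the congruences, \<open>G_w = p_w - s p_{s w}\<close> again satisfies
  them, because the multiplicities are invariant and \<open>W\<close> permutes the hyperplanes. Each \<open>G_w\<close>
  vanishes on \<open>H_\<alpha>\<close> and is therefore divisible by \<open>\<alpha>\<close>. The division preserves the congruences at the
  other hyperplanes, whose forms are coprime to \<open>\<alpha>\<close>. At \<open>H_\<alpha>\<close>, writing \<open>p_w - p_{s w} = \<alpha>^(2k+1) q\<close>
  and using \<open>s \<alpha> = - \<alpha>\<close> gives \<open>G_w - G_{s w} = \<alpha>^(2k+1) (q - s q)\<close>, and \<open>q - s q\<close> supplies the factor
  \<open>\<alpha>\<close> lost in the division.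
\<close>

section \<open>Polynomial functions\<close>

text \<open>Polynomials occur as functions on V, so factors are handled through values. Divisibility
  by a linear form is read off from vanishing on its kernel, and a factor \<open>\<alpha> H\<close>
  is cancelled by restricting to a line, where a nonzero polynomial in one variable over an infinite
  field has a nonroot. The cofactor in a congruence must be polynomial on all of V; hence the
  calculations are made with polynomial families on V, which are extended by zero from V_reg only
  afterwards. The exponent 2k+1 enters through its parity. With an even exponent m the same
  computation at H_\<alpha> would give \<alpha>^m (q + s q), and q + s q need not vanish on
  H_\<alpha>, so the lost factor would not come back. Oddness also excludes the exponent 0, and a
  positive exponent is what makes G_w vanish on H_\<alpha>. Stability is the whole content of the
  module structure: the crossed product already acts associatively on the tensor space, so an
  additive subgroup stable under the generators is a module over the ring that they
  generate.\<close>

context vector_space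
begin

lemma linear_functional_iff:
  "Vector_Spaces.linear scale (*) f \<longleftrightarrow>
     (\<forall>x y. f (x + y) = f x + f y) \<and> (\<forall>c x. f (scale c x) = c * f x)"
proof -
  have "vector_space ((*) :: 'a \<Rightarrow> 'a \<Rightarrow> 'a)"
    by unfold_locales (auto simp: algebra_simps)
  then show ?thesis
    by (simp add: Vector_Spaces.linear_iff vector_space_axioms)
qed

lemma polyfuns_uminus:
  assumes "f \<in> polyfuns scale"
  shows "(\<lambda>v. - f v) \<in> polyfuns scale"
  using polyfuns.mult[OF polyfuns.const[of "- 1"] assms] by simp

lemma polyfuns_diff:
  assumes "f \<in> polyfuns scale" "g \<in> polyfuns scale"
  shows "(\<lambda>v. f v - g v) \<in> polyfuns scale"
  using polyfuns.add[OF assms(1) polyfuns_uminus[OF assms(2)]] by simp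

lemma polyfuns_prod:
  assumes "\<And>i. i \<in> I \<Longrightarrow> f i \<in> polyfuns scale"
  shows "(\<lambda>v. \<Prod>i\<in>I. f i v) \<in> polyfuns scale"
  using assms by (induction I rule: infinite_finite_induct) (auto intro: polyfuns.const polyfuns.mult)

lemma polyfuns_power:
  assumes "f \<in> polyfuns scale"
  shows "(\<lambda>v. f v ^ n) \<in> polyfuns scale"
  using assms by (induction n) (auto intro: polyfuns.const polyfuns.mult)

lemma polyfuns_compose_linear:
  assumes "Vector_Spaces.linear scale scale T" "f \<in> polyfuns scale"
  shows "(\<lambda>v. f (T v)) \<in> polyfuns scale"
  using assms(2)
proof induction
  case (form f)
  have "Vector_Spaces.linear scale (*) (\<lambda>v. f (T v))"
    using form assms(1) by (simp add: Vector_Spaces.linear_iff)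
  then show ?case
    by (rule polyfuns.form)
qed (auto intro: polyfuns.intros)

lemma polyfuns_on_line:
  assumes "f \<in> polyfuns scale"
  obtains P where "\<And>t. f (a + scale t b) = poly P t"
proof -
  have "\<exists>P. \<forall>t. f (a + scale t b) = poly P t"
    using assms
  proof induction
    case (const c)
    show ?case by (rule exI[of _ "[:c:]"]) simp
  next
    case (form f)
    then show ?case
      by (intro exI[of _ "[:f a, f b:]"]) (simp add: linear_functional_iff)
  next
    case (add f g)
    then show ?case by (metis poly_add)
  next
    case (mult f g)
    then show ?case by (metis poly_mult)
  qed
  then show ?thesis using that by blast
qed

text \<open>Subtracting \<open>g v / g e\<close> times \<open>e\<close> from \<open>v\<close> gives
  a vector in the common kernel, which forces the ratio \<open>f e / g e\<close>.\<close>

lemma linear_functional_kernel_eq: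
  assumes f: "Vector_Spaces.linear scale (*) f" and g: "Vector_Spaces.linear scale (*) g"
    and ker: "\<And>v. f v = 0 \<longleftrightarrow> g v = 0" and e: "g e \<noteq> 0"
  shows "\<exists>c. c \<noteq> 0 \<and> (\<forall>v. f v = c * g v)"
proof (intro exI[of _ "f e / g e"] conjI allI)
  show "f e / g e \<noteq> 0"
    using e ker by simp
  fix v
  have "g (v + scale (- (g v / g e)) e) = 0"
    using g e by (simp only: linear_functional_iff) simp
  then have "f (v + scale (- (g v / g e)) e) = 0"
    by (simp add: ker)
  then have "f v + (- (g v / g e)) * f e = 0"
    using f by (simp only: linear_functional_iff)
  then show "f v = f e / g e * g v"
    using e by (simp add: field_simps)
qed

text \<open>
  If \<open>\<pi>\<close> is the projection onto the kernel of \<open>\<phi>\<close> along \<open>e\<close>, then \<open>f - f \<circ> \<pi>\<close> is divisible by \<open>\<phi>\<close>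
  for every polynomial function \<open>f\<close>.
\<close>

lemma polyfuns_divisible_by_form:
  assumes phi: "Vector_Spaces.linear scale (*) \<phi>" and e: "\<phi> e \<noteq> 0"
    and f: "f \<in> polyfuns scale" and van: "\<And>v. \<phi> v = 0 \<Longrightarrow> f v = 0"
  obtains q where "q \<in> polyfuns scale" "\<And>v. f v = \<phi> v * q v"
proof -
  \<comment> \<open>Scaling \<open>e\<close> to \<open>\<phi> d = 1\<close> makes
    \<open>v - scale (\<phi> v) d\<close> land in the kernel of \<open>\<phi>\<close>.\<close>
  define d where "d = scale (1 / \<phi> e) e"
  have d: "\<phi> d = 1"
    using phi e by (simp add: d_def linear_functional_iff)
  define \<pi> where "\<pi> v = v - scale (\<phi> v) d" for v
  have lin: "Vector_Spaces.linear scale scale \<pi>"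
    using phi by (auto simp: Vector_Spaces.linear_iff vector_space_axioms \<pi>_def scale_left_distrib
        scale_right_diff_distrib)
  have \<pi>: "\<phi> (\<pi> v) = 0" for v
  proof -
    have "\<phi> (v + scale (- \<phi> v) d) = 0"
      using phi d by (simp only: linear_functional_iff) simp
    then show ?thesis by (simp add: \<pi>_def)
  qed
  have "\<exists>q\<in>polyfuns scale. \<forall>v. f v - f (\<pi> v) = \<phi> v * q v"
    using f
  proof induction
    case (const c)
    show ?case by (rule bexI[of _ "\<lambda>_. 0"]) (auto intro: polyfuns.const)
  next
    case (form f)
    have "f v - f (\<pi> v) = \<phi> v * f d" for v
    proof -
      have "f (v + scale (- \<phi> v) d) = f v + (- \<phi> v) * f d"
        using form by (simp only: linear_functional_iff)
      then show ?thesis by (simp add: \<pi>_def)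
    qed
    then show ?case by (intro bexI[of _ "\<lambda>_. f d"]) (auto intro: polyfuns.const)
  next
    case (add f g)
    then obtain p q where p: "p \<in> polyfuns scale" "\<And>v. f v - f (\<pi> v) = \<phi> v * p v"
      and q: "q \<in> polyfuns scale" "\<And>v. g v - g (\<pi> v) = \<phi> v * q v"
      by blast
    show ?case
      using p(1) q(1)
      by (intro bexI[of _ "\<lambda>v. p v + q v"])
        (auto intro: polyfuns.add simp: distrib_left add_diff_add p(2) q(2))
  next
    case (mult f g)
    then obtain p q where p: "p \<in> polyfuns scale" "\<And>v. f v - f (\<pi> v) = \<phi> v * p v"
      and q: "q \<in> polyfuns scale" "\<And>v. g v - g (\<pi> v) = \<phi> v * q v"
      by blast
    \<comment> \<open>The difference of products telescopes. The cofactor contains \<open>g\<close>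
      composed with \<open>\<pi>\<close>, which is polynomial because \<open>\<pi>\<close> is
      linear.\<close>
    have "f v * g v - f (\<pi> v) * g (\<pi> v) = \<phi> v * (f v * q v + p v * g (\<pi> v))" for v
    proof -
      have "f v * g v - f (\<pi> v) * g (\<pi> v) = f v * (g v - g (\<pi> v)) + (f v - f (\<pi> v)) * g (\<pi> v)"
        by (simp add: algebra_simps)
      then show ?thesis
        by (simp only: p q) (simp add: algebra_simps)
    qed
    then show ?case
      using polyfuns.add[OF polyfuns.mult[OF mult.hyps(1) q(1)]
          polyfuns.mult[OF p(1) polyfuns_compose_linear[OF lin mult.hyps(2)]]]
      by (intro bexI[where x = "\<lambda>v. f v * q v + p v * g (\<pi> v)"] allI)
  qed
  then show ?thesis
    using that van \<pi> by auto
qed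

end

text \<open>On the line through \<open>a\<close> and \<open>b\<close> the restriction of
  \<open>f\<close> is nonzero at parameter 0 and that of \<open>g\<close> at parameter 1, so the
  product of the two univariate polynomials is nonzero and has a nonroot. All density arguments
  below rest on this.\<close>

lemma polyfuns_common_nonzero:
  fixes scale :: "'k::field_char_0 \<Rightarrow> 'v::ab_group_add \<Rightarrow> 'v"
  assumes "vector_space scale" "f \<in> polyfuns scale" "g \<in> polyfuns scale" "f a \<noteq> 0" "g b \<noteq> 0"
  obtains t where "f (a + scale t (b - a)) \<noteq> 0" "g (a + scale t (b - a)) \<noteq> 0"
proof -
  interpret vector_space scale by fact
  obtain P where P: "\<And>t. f (a + scale t (b - a)) = poly P t"
    using polyfuns_on_line[OF assms(2)] by metis
  obtain Q where Q: "\<And>t. g (a + scale t (b - a)) = poly Q t"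
    using polyfuns_on_line[OF assms(3)] by metis
  have "P \<noteq> 0" "Q \<noteq> 0"
    using P[of 0] Q[of 1] assms(4,5) by auto
  then have "P * Q \<noteq> 0" by simp
  then obtain t where "poly (P * Q) t \<noteq> 0"
    using poly_all_0_iff_0 by blast
  then show ?thesis
    using that[of t] by (simp add: P Q)
qed

text \<open>Applied to the forms of all hyperplanes, this shows that V_reg is not empty.\<close>

lemma polyfuns_prod_nonzero:
  fixes scale :: "'k::field_char_0 \<Rightarrow> 'v::ab_group_add \<Rightarrow> 'v"
  assumes vs: "vector_space scale" and "finite I"
    and "\<And>i. i \<in> I \<Longrightarrow> f i \<in> polyfuns scale" and "\<And>i. i \<in> I \<Longrightarrow> \<exists>v. f i v \<noteq> 0"
  shows "\<exists>v. (\<Prod>i\<in>I. f i v) \<noteq> 0"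
  using assms(2-)
proof (induction I)
  case (insert i I)
  then obtain a b where "f i a \<noteq> 0" "(\<Prod>i\<in>I. f i b) \<noteq> 0"
    by (meson insertCI)
  moreover have "(\<lambda>v. \<Prod>i\<in>I. f i v) \<in> polyfuns scale"
    using insert.prems by (intro vector_space.polyfuns_prod[OF vs]) simp
  ultimately obtain t where "f i (a + scale t (b - a)) \<noteq> 0" "(\<Prod>i\<in>I. f i (a + scale t (b - a))) \<noteq> 0"
    using polyfuns_common_nonzero[OF vs, of "f i"] insert.prems(1) by (metis insertI1)
  then show ?case
    using insert.hyps by auto
qed simp

section \<open>Reflections and their hyperplanes\<close>

locale reflection_forms =
  coxeter_reflection_rep scale Basis W \<rho> S
  for scale :: "'k::field_char_0 \<Rightarrow> 'v::ab_group_add \<Rightarrow> 'v"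
    and Basis :: "'v set"
    and W :: "('g, 'c) monoid_scheme"
    and \<rho> :: "'g \<Rightarrow> 'v \<Rightarrow> 'v"
    and S :: "'g set" +
  fixes \<alpha> :: "'v set \<Rightarrow> 'v \<Rightarrow> 'k"
  assumes forms: "hyperplane_forms scale W \<rho> \<alpha>"
begin

abbreviation "\<A> \<equiv> arrangement scale W \<rho>"
abbreviation "\<sigma> \<equiv> hyper_refl scale W \<rho>"
abbreviation "rst \<equiv> res scale W \<rho>"

sublocale G: group W
  using coxeter by (simp add: coxeter_system_def)

lemma rho_mult [simp]: "x \<in> carrier W \<Longrightarrow> y \<in> carrier W \<Longrightarrow> \<rho> (x \<otimes>\<^bsub>W\<^esub> y) v = \<rho> x (\<rho> y v)"
  using composition_rule by blast

lemma rho_one [simp]: "\<rho> \<one>\<^bsub>W\<^esub> v = v"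
  using id_eq_one by (metis UNIV_I restrict_apply')

lemma rho_inv [simp]:
  assumes "w \<in> carrier W"
  shows "\<rho> (inv\<^bsub>W\<^esub> w) (\<rho> w v) = v" "\<rho> w (\<rho> (inv\<^bsub>W\<^esub> w) v) = v"
  using assms by (simp_all flip: rho_mult)

lemma rho_add: "w \<in> carrier W \<Longrightarrow> \<rho> w (u + v) = \<rho> w u + \<rho> w v"
  using linear_rep by (simp add: Vector_Spaces.linear_iff)

lemma rho_scale: "w \<in> carrier W \<Longrightarrow> \<rho> w (scale c v) = scale c (\<rho> w v)"
  using linear_rep by (simp add: Vector_Spaces.linear_iff)

lemma rho_eqI:
  assumes "x \<in> carrier W" "y \<in> carrier W" "\<And>v. \<rho> x v = \<rho> y v"
  shows "x = y"
  using faithful assms by (auto simp: inj_on_def fun_eq_iff)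

lemma polyfuns_rho: "w \<in> carrier W \<Longrightarrow> f \<in> polyfuns scale \<Longrightarrow> (\<lambda>v. f (\<rho> w v)) \<in> polyfuns scale"
  by (rule polyfuns_compose_linear[OF linear_rep])

lemma finite_arrangement: "finite \<A>"
  using finite_W by (simp add: arrangement_def reflections_def)

lemma refl_props:
  assumes "H \<in> \<A>"
  shows refl_carrier: "\<sigma> H \<in> carrier W"
    and is_reflection_refl: "is_reflection scale (\<rho> (\<sigma> H))"
    and refl_fixed: "\<rho> (\<sigma> H) v = v \<longleftrightarrow> v \<in> H"
proof -
  have "\<sigma> H \<in> reflections scale W \<rho> \<and> fixed_space \<rho> (\<sigma> H) = H"
    unfolding hyper_refl_def by (rule theI'[OF reflection_unique[OF assms]])
  then show "\<sigma> H \<in> carrier W" "is_reflection scale (\<rho> (\<sigma> H))" "\<rho> (\<sigma> H) v = v \<longleftrightarrow> v \<in> H"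
    by (auto simp: reflections_def fixed_space_def)
qed

lemma refl_eqI:
  assumes "s \<in> reflections scale W \<rho>" "fixed_space \<rho> s = H"
  shows "\<sigma> H = s"
proof -
  have "H \<in> \<A>"
    using assms by (auto simp: arrangement_def)
  from the1_equality[OF reflection_unique[OF this]] assms show ?thesis
    by (simp add: hyper_refl_def)
qed

lemma rho_refl_refl [simp]: "H \<in> \<A> \<Longrightarrow> \<rho> (\<sigma> H) (\<rho> (\<sigma> H) v) = v"
  using is_reflection_refl[of H] by (auto simp: is_reflection_def fun_eq_iff)

lemma refl_square [simp]: "H \<in> \<A> \<Longrightarrow> \<sigma> H \<otimes>\<^bsub>W\<^esub> \<sigma> H = \<one>\<^bsub>W\<^esub>"
  by (rule rho_eqI) (auto simp: refl_carrier)

lemma inv_refl [simp]: "H \<in> \<A> \<Longrightarrow> inv\<^bsub>W\<^esub> (\<sigma> H) = \<sigma> H"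
  by (simp add: G.inv_equality refl_carrier)

lemma conjugate_reflection:
  assumes H: "H \<in> \<A>" and w: "w \<in> carrier W"
  shows arrangement_image: "\<rho> w ` H \<in> \<A>"
    and refl_image: "\<sigma> (\<rho> w ` H) = w \<otimes>\<^bsub>W\<^esub> \<sigma> H \<otimes>\<^bsub>W\<^esub> inv\<^bsub>W\<^esub> w"
proof -
  define s where "s = w \<otimes>\<^bsub>W\<^esub> \<sigma> H \<otimes>\<^bsub>W\<^esub> inv\<^bsub>W\<^esub> w"
  have s: "s \<in> carrier W"
    using H w by (simp add: s_def refl_carrier)
  have s_app: "\<rho> s v = \<rho> w (\<rho> (\<sigma> H) (\<rho> (inv\<^bsub>W\<^esub> w) v))" for v
    using H w by (simp add: s_def refl_carrier)
  have fixed: "\<rho> s v = v \<longleftrightarrow> v \<in> \<rho> w ` H" for v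
  proof -
    have "\<rho> s v = v \<longleftrightarrow> \<rho> (\<sigma> H) (\<rho> (inv\<^bsub>W\<^esub> w) v) = \<rho> (inv\<^bsub>W\<^esub> w) v"
      using w rho_inv s_app by metis
    also have "\<dots> \<longleftrightarrow> v \<in> \<rho> w ` H"
      unfolding refl_fixed[OF H] using w rho_inv by (metis image_iff)
    finally show ?thesis .
  qed
  interpret pair: finite_dimensional_vector_space_pair_1 scale Basis scale
    by unfold_locales
  have inj: "inj (\<rho> w)"
    using w by (metis injI rho_inv(1))
  have "dim {v. \<rho> s v = v} = dim {v. \<rho> (\<sigma> H) v = v}"
  proof -
    have "{v. \<rho> s v = v} = \<rho> w ` {v. \<rho> (\<sigma> H) v = v}"
      using fixed refl_fixed[OF H] by auto
    then show ?thesis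
      using pair.dim_image_eq[OF linear_rep[OF w] inj_on_subset[OF inj]] by simp
  qed
  moreover obtain v where "\<rho> (\<sigma> H) v \<noteq> v"
    using is_reflection_refl[OF H] by (auto simp: is_reflection_def fun_eq_iff)
  then have "\<rho> s (\<rho> w v) \<noteq> \<rho> w v"
    using w inj by (simp add: s_app inj_eq)
  then have "\<rho> s \<noteq> id"
    by auto
  moreover have "\<rho> s \<circ> \<rho> s = id"
    using H w by (simp add: fun_eq_iff s_app)
  ultimately have "is_reflection scale (\<rho> s)"
    using is_reflection_refl[OF H] linear_rep[OF s] by (simp add: is_reflection_def)
  then have "s \<in> reflections scale W \<rho>" "fixed_space \<rho> s = \<rho> w ` H"
    using s fixed by (auto simp: reflections_def fixed_space_def)
  then show "\<rho> w ` H \<in> \<A>" "\<sigma> (\<rho> w ` H) = w \<otimes>\<^bsub>W\<^esub> \<sigma> H \<otimes>\<^bsub>W\<^esub> inv\<^bsub>W\<^esub> w"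
    using refl_eqI by (auto simp: arrangement_def s_def)
qed

section \<open>Linear forms of the hyperplanes\<close>

lemma form_linear: "H \<in> \<A> \<Longrightarrow> Vector_Spaces.linear scale (*) (\<alpha> H)"
  using forms by (simp add: hyperplane_forms_def)

lemma form_eq_0_iff: "H \<in> \<A> \<Longrightarrow> \<alpha> H v = 0 \<longleftrightarrow> v \<in> H"
  using forms by (auto simp: hyperplane_forms_def)

lemma form_nonzero:
  assumes "H \<in> \<A>"
  obtains e where "\<alpha> H e \<noteq> 0"
  using is_reflection_refl[OF assms] that
  by (auto simp: is_reflection_def fun_eq_iff refl_fixed[OF assms] form_eq_0_iff[OF assms])

text \<open>The sum of \<open>v\<close> and its mirror image is fixed by the reflection, hence lies
  in the kernel \<open>H\<close> of the form.\<close>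

lemma form_refl:
  assumes "H \<in> \<A>"
  shows "\<alpha> H (\<rho> (\<sigma> H) v) = - \<alpha> H v"
proof -
  have "v + \<rho> (\<sigma> H) v \<in> H"
    using assms by (simp only: refl_fixed[OF assms, symmetric] rho_add refl_carrier rho_refl_refl add.commute)
  then have "\<alpha> H (v + \<rho> (\<sigma> H) v) = 0"
    using assms by (simp add: form_eq_0_iff)
  then have "\<alpha> H v + \<alpha> H (\<rho> (\<sigma> H) v) = 0"
    using form_linear[OF assms] by (simp add: linear_functional_iff)
  then show ?thesis
    by (simp add: eq_neg_iff_add_eq_0 add.commute)
qed

lemma form_translate:
  assumes H: "H \<in> \<A>" and w: "w \<in> carrier W"
  obtains c where "c \<noteq> 0" "\<And>v. \<alpha> H (\<rho> (inv\<^bsub>W\<^esub> w) v) = c * \<alpha> (\<rho> w ` H) v"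
proof -
  have H': "\<rho> w ` H \<in> \<A>"
    using H w by (rule arrangement_image)
  obtain e where e: "\<alpha> (\<rho> w ` H) e \<noteq> 0"
    using form_nonzero[OF H'] .
  have "Vector_Spaces.linear scale (*) (\<lambda>v. \<alpha> H (\<rho> (inv\<^bsub>W\<^esub> w) v))"
    using form_linear[OF H] w by (simp add: linear_functional_iff rho_add rho_scale)
  moreover have "\<alpha> H (\<rho> (inv\<^bsub>W\<^esub> w) v) = 0 \<longleftrightarrow> \<alpha> (\<rho> w ` H) v = 0" for v
    unfolding form_eq_0_iff[OF H] form_eq_0_iff[OF H'] using w rho_inv by (metis image_iff)
  ultimately show ?thesis
    using linear_functional_kernel_eq[OF _ form_linear[OF H'] _ e] that by blast
qed

text \<open>
  Distinct hyperplanes have coprime forms: the cofactor \<open>r\<close> vanishes on \<open>H\<close>, because \<open>\<alpha> H'\<close> does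
  not vanish identically there.
\<close>

lemma form_coprime:
  assumes H: "H \<in> \<A>" and H': "H' \<in> \<A>" and ne: "H \<noteq> H'"
    and r: "r \<in> polyfuns scale" and eq: "\<And>v. \<alpha> H v * h v = \<alpha> H' v ^ n * r v"
  obtains q where "q \<in> polyfuns scale" "\<And>v. r v = \<alpha> H v * q v"
proof -
  obtain b where b: "b \<in> H" "\<alpha> H' b \<noteq> 0"
  proof (rule ccontr)
    assume "\<not> thesis"
    then have sub: "\<And>v. \<alpha> H v = 0 \<Longrightarrow> \<alpha> H' v = 0"
      using that form_eq_0_iff[OF H] by blast
    obtain e where e: "\<alpha> H e \<noteq> 0"
      using form_nonzero[OF H] .
    obtain e' where e': "\<alpha> H' e' \<noteq> 0"
      using form_nonzero[OF H'] .
    obtain q where q: "\<And>v. \<alpha> H' v = \<alpha> H v * q v" "q \<in> polyfuns scale"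
      using polyfuns_divisible_by_form[OF form_linear[OF H] e polyfuns.form[OF form_linear[OF H']] sub]
      by metis
    have "v \<in> H" if v: "v \<in> H'" for v
    proof -
      \<comment> \<open>The coefficients are chosen so that \<open>\<alpha> H\<close> kills
        \<open>?d\<close>. Then \<open>\<alpha> H'\<close> kills it too, and since
        \<open>\<alpha> H' v = 0\<close> only the \<open>e'\<close> term survives there.\<close>
      let ?d = "scale (\<alpha> H v) e' + scale (- \<alpha> H e') v"
      have "\<alpha> H ?d = 0"
        using form_linear[OF H] by (simp only: linear_functional_iff) simp
      then have "\<alpha> H' ?d = 0"
        by (rule sub)
      then have "\<alpha> H v * \<alpha> H' e' + - \<alpha> H e' * \<alpha> H' v = 0"
        using form_linear[OF H'] by (simp only: linear_functional_iff)
      moreover have "\<alpha> H' v = 0"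
        using v form_eq_0_iff[OF H'] by blast
      ultimately have "\<alpha> H v = 0"
        using e' by simp
      then show ?thesis
        using form_eq_0_iff[OF H] by blast
    qed
    moreover have "v \<in> H'" if "v \<in> H" for v
      using that sub form_eq_0_iff[OF H] form_eq_0_iff[OF H'] by blast
    ultimately show False using ne by blast
  qed
  \<comment> \<open>The line from \<open>v\<close> to \<open>b\<close> stays inside
    \<open>H\<close>, so the left side of \<open>eq\<close> vanishes along it. If \<open>r v\<close>
    were nonzero, some point of the line would make the right side nonzero.\<close>
  have "r v = 0" if v: "\<alpha> H v = 0" for v
  proof (rule ccontr)
    assume "r v \<noteq> 0"
    obtain t where t: "r (v + scale t (b - v)) \<noteq> 0" "\<alpha> H' (v + scale t (b - v)) \<noteq> 0"
      using polyfuns_common_nonzero[OF vector_space_axioms r polyfuns.form[OF form_linear[OF H']]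
          \<open>r v \<noteq> 0\<close> b(2)] .
    have "\<alpha> H b = 0"
      using b(1) form_eq_0_iff[OF H] by blast
    then have "\<alpha> H (v + scale t (b + scale (- 1) v)) = 0"
      using form_linear[OF H] v by (simp only: linear_functional_iff) simp
    then show False
      using eq[of "v + scale t (b - v)"] t by simp
  qed
  moreover obtain e where e: "\<alpha> H e \<noteq> 0"
    using form_nonzero[OF H] .
  ultimately show ?thesis
    using polyfuns_divisible_by_form[OF form_linear[OF H] e r] that by blast
qed

text \<open>Off \<open>H\<close> one may divide by the form. If the two functions differed at some
  \<open>v\<close>, possibly in \<open>H\<close>, then \<open>\<alpha> H\<close> and
  \<open>f - g\<close> would be nonzero at a common point.\<close>

lemma form_cancel:
  assumes H: "H \<in> \<A>" and "f \<in> polyfuns scale" "g \<in> polyfuns scale"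
    and eq: "\<And>v. \<alpha> H v * f v = \<alpha> H v * g v"
  shows "f v = g v"
proof (rule ccontr)
  assume ne: "f v \<noteq> g v"
  obtain e where e: "\<alpha> H e \<noteq> 0"
    using form_nonzero[OF H] .
  obtain t where "\<alpha> H (e + scale t (v - e)) \<noteq> 0" "f (e + scale t (v - e)) - g (e + scale t (v - e)) \<noteq> 0"
    using polyfuns_common_nonzero[OF vector_space_axioms polyfuns.form[OF form_linear[OF H]]
        polyfuns_diff[OF assms(2,3)] e] ne by auto
  then show False
    using eq by auto
qed

lemma form_dvd:
  assumes H: "H \<in> \<A>" and "f \<in> polyfuns scale" and "\<And>v. v \<in> H \<Longrightarrow> f v = 0"
  obtains q where "q \<in> polyfuns scale" "\<And>v. f v = \<alpha> H v * q v"
proof -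
  obtain e where e: "\<alpha> H e \<noteq> 0"
    using form_nonzero[OF H] .
  show ?thesis
    using polyfuns_divisible_by_form[OF form_linear[OF H] e assms(2)] assms(3) that
      form_eq_0_iff[OF H] by blast
qed

section \<open>Polynomial families satisfying the congruences\<close>

text \<open>These are the polynomial representatives on all of V of the elements of
  \<open>quasi_covariants\<close>, before their values outside V_reg are replaced by zero.
  Divisibility arguments need the values on the hyperplanes.\<close>

definition quasi_covariant_family :: "('v set \<Rightarrow> nat) \<Rightarrow> ('g \<Rightarrow> 'v \<Rightarrow> 'k) \<Rightarrow> bool" where
  "quasi_covariant_family m p \<longleftrightarrow>
     (\<forall>w \<in> carrier W. p w \<in> polyfuns scale) \<and>
     (\<forall>H \<in> \<A>. \<forall>w \<in> carrier W. \<exists>q \<in> polyfuns scale.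
        \<forall>v. p w v - p (\<sigma> H \<otimes>\<^bsub>W\<^esub> w) v = \<alpha> H v ^ m H * q v)"

lemma quasi_covariant_familyI:
  assumes "\<And>w. w \<in> carrier W \<Longrightarrow> p w \<in> polyfuns scale"
    and "\<And>H w. H \<in> \<A> \<Longrightarrow> w \<in> carrier W \<Longrightarrow> \<exists>q \<in> polyfuns scale.
      \<forall>v. p w v - p (\<sigma> H \<otimes>\<^bsub>W\<^esub> w) v = \<alpha> H v ^ m H * q v"
  shows "quasi_covariant_family m p"
  using assms by (simp add: quasi_covariant_family_def)

lemma quasi_covariant_family_polyfuns:
  "quasi_covariant_family m p \<Longrightarrow> w \<in> carrier W \<Longrightarrow> p w \<in> polyfuns scale"
  by (simp add: quasi_covariant_family_def)

lemma quasi_covariant_family_congruence: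
  assumes "quasi_covariant_family m p" "H \<in> \<A>" "w \<in> carrier W"
  obtains q where "q \<in> polyfuns scale" "\<And>v. p w v - p (\<sigma> H \<otimes>\<^bsub>W\<^esub> w) v = \<alpha> H v ^ m H * q v"
  using assms unfolding quasi_covariant_family_def by blast

lemma quasi_covariant_family_const:
  "f \<in> polyfuns scale \<Longrightarrow> quasi_covariant_family m (\<lambda>_. f)"
  by (rule quasi_covariant_familyI) (auto intro!: bexI[of _ "\<lambda>_. 0"] polyfuns.const)

lemma quasi_covariant_family_add:
  assumes p: "quasi_covariant_family m p" and q: "quasi_covariant_family m q"
  shows "quasi_covariant_family m (\<lambda>w v. p w v + q w v)"
proof (rule quasi_covariant_familyI)
  show "(\<lambda>v. p w v + q w v) \<in> polyfuns scale" if "w \<in> carrier W" for w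
    using p q that by (intro polyfuns.add quasi_covariant_family_polyfuns)
  fix H w assume Hw: "H \<in> \<A>" "w \<in> carrier W"
  obtain a where a: "a \<in> polyfuns scale" "\<And>v. p w v - p (\<sigma> H \<otimes>\<^bsub>W\<^esub> w) v = \<alpha> H v ^ m H * a v"
    using quasi_covariant_family_congruence[OF p Hw] by blast
  obtain b where b: "b \<in> polyfuns scale" "\<And>v. q w v - q (\<sigma> H \<otimes>\<^bsub>W\<^esub> w) v = \<alpha> H v ^ m H * b v"
    using quasi_covariant_family_congruence[OF q Hw] by blast
  show "\<exists>r\<in>polyfuns scale. \<forall>v. p w v + q w v - (p (\<sigma> H \<otimes>\<^bsub>W\<^esub> w) v + q (\<sigma> H \<otimes>\<^bsub>W\<^esub> w) v)
      = \<alpha> H v ^ m H * r v"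
    by (rule bexI[OF _ polyfuns.add[OF a(1) b(1)]]) (simp add: add_diff_add a(2) b(2) distrib_left)
qed

text \<open>The difference of products telescopes into two multiples of the same power of the form.
  With a constant family as one factor, this also covers multiplication by k[V].\<close>

lemma quasi_covariant_family_mult:
  assumes p: "quasi_covariant_family m p" and q: "quasi_covariant_family m q"
  shows "quasi_covariant_family m (\<lambda>w v. p w v * q w v)"
proof (rule quasi_covariant_familyI)
  show "(\<lambda>v. p w v * q w v) \<in> polyfuns scale" if "w \<in> carrier W" for w
    using p q that by (intro polyfuns.mult quasi_covariant_family_polyfuns)
  fix H w assume Hw: "H \<in> \<A>" "w \<in> carrier W"
  define w' where "w' = \<sigma> H \<otimes>\<^bsub>W\<^esub> w"
  have w': "w' \<in> carrier W"
    using Hw by (simp add: w'_def refl_carrier)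
  obtain a where a: "a \<in> polyfuns scale" "\<And>v. p w v - p w' v = \<alpha> H v ^ m H * a v"
    using quasi_covariant_family_congruence[OF p Hw] unfolding w'_def by blast
  obtain b where b: "b \<in> polyfuns scale" "\<And>v. q w v - q w' v = \<alpha> H v ^ m H * b v"
    using quasi_covariant_family_congruence[OF q Hw] unfolding w'_def by blast
  have "p w v * q w v - p w' v * q w' v = \<alpha> H v ^ m H * (p w v * b v + a v * q w' v)" for v
  proof -
    have "p w v * q w v - p w' v * q w' v = p w v * (q w v - q w' v) + (p w v - p w' v) * q w' v"
      by (simp add: algebra_simps)
    then show ?thesis
      by (simp only: a b) (simp add: algebra_simps)
  qed
  moreover have "(\<lambda>v. p w v * b v + a v * q w' v) \<in> polyfuns scale"
    using polyfuns.add[OF polyfuns.mult[OF quasi_covariant_family_polyfuns[OF p Hw(2)] b(1)]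
        polyfuns.mult[OF a(1) quasi_covariant_family_polyfuns[OF q w']]] .
  ultimately show "\<exists>r\<in>polyfuns scale.
      \<forall>v. p w v * q w v - p (\<sigma> H \<otimes>\<^bsub>W\<^esub> w) v * q (\<sigma> H \<otimes>\<^bsub>W\<^esub> w) v = \<alpha> H v ^ m H * r v"
    unfolding w'_def by (intro bexI[where x = "\<lambda>v. p w v * b v + a v * q (\<sigma> H \<otimes>\<^bsub>W\<^esub> w) v"] allI)
qed

lemma quasi_covariant_family_uminus:
  assumes "quasi_covariant_family m p"
  shows "quasi_covariant_family m (\<lambda>w v. - p w v)"
  using quasi_covariant_family_mult[OF quasi_covariant_family_const[OF polyfuns.const[of "- 1"]] assms]
  by simp

lemma quasi_covariant_family_diff:
  assumes "quasi_covariant_family m p" "quasi_covariant_family m q"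
  shows "quasi_covariant_family m (\<lambda>w v. p w v - q w v)"
  using quasi_covariant_family_add[OF assms(1) quasi_covariant_family_uminus[OF assms(2)]] by simp

text \<open>This is the action of the group element \<open>u\<close>. The congruence of the
  translate at \<open>H\<close> comes from that of \<open>p\<close> at the hyperplane
  \<open>H0\<close>, the image of \<open>H\<close> under the inverse of \<open>u\<close>. Invariance
  of \<open>m\<close> makes the exponents agree, and the constant relating the forms is absorbed
  into the cofactor.\<close>

lemma quasi_covariant_family_translate:
  assumes m: "m \<in> multiplicities scale W \<rho>" and u: "u \<in> carrier W"
    and p: "quasi_covariant_family m p"
  shows "quasi_covariant_family m (\<lambda>w v. p (inv\<^bsub>W\<^esub> u \<otimes>\<^bsub>W\<^esub> w) (\<rho> (inv\<^bsub>W\<^esub> u) v))"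
proof (rule quasi_covariant_familyI)
  show "(\<lambda>v. p (inv\<^bsub>W\<^esub> u \<otimes>\<^bsub>W\<^esub> w) (\<rho> (inv\<^bsub>W\<^esub> u) v)) \<in> polyfuns scale" if "w \<in> carrier W" for w
    using p u that by (intro polyfuns_rho quasi_covariant_family_polyfuns) auto
  fix H w assume H: "H \<in> \<A>" and w: "w \<in> carrier W"
  define H0 where "H0 = \<rho> (inv\<^bsub>W\<^esub> u) ` H"
  have H0: "H0 \<in> \<A>" and s: "\<sigma> H0 = inv\<^bsub>W\<^esub> u \<otimes>\<^bsub>W\<^esub> \<sigma> H \<otimes>\<^bsub>W\<^esub> u"
    using conjugate_reflection[OF H G.inv_closed[OF u]] u by (simp_all add: H0_def)
  have H0H: "\<rho> u ` H0 = H"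
    using u by (simp add: H0_def image_image)
  have mH: "m H0 = m H"
    using m H u by (simp add: multiplicities_def H0_def)
  have shift: "\<sigma> H0 \<otimes>\<^bsub>W\<^esub> (inv\<^bsub>W\<^esub> u \<otimes>\<^bsub>W\<^esub> w) = inv\<^bsub>W\<^esub> u \<otimes>\<^bsub>W\<^esub> (\<sigma> H \<otimes>\<^bsub>W\<^esub> w)"
  proof -
    have "u \<otimes>\<^bsub>W\<^esub> (inv\<^bsub>W\<^esub> u \<otimes>\<^bsub>W\<^esub> w) = w"
      using u w by (simp flip: G.m_assoc)
    then show ?thesis
      using u w H by (simp add: s G.m_assoc refl_carrier)
  qed
  obtain c where c: "\<And>v. \<alpha> H0 (\<rho> (inv\<^bsub>W\<^esub> u) v) = c * \<alpha> H v"
    using form_translate[OF H0 u] unfolding H0H by blast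
  obtain q where q: "q \<in> polyfuns scale"
    "\<And>v. p (inv\<^bsub>W\<^esub> u \<otimes>\<^bsub>W\<^esub> w) v - p (\<sigma> H0 \<otimes>\<^bsub>W\<^esub> (inv\<^bsub>W\<^esub> u \<otimes>\<^bsub>W\<^esub> w)) v = \<alpha> H0 v ^ m H0 * q v"
    using quasi_covariant_family_congruence[OF p H0, of "inv\<^bsub>W\<^esub> u \<otimes>\<^bsub>W\<^esub> w"] u w by auto
  have "(\<lambda>v. c ^ m H * q (\<rho> (inv\<^bsub>W\<^esub> u) v)) \<in> polyfuns scale"
    by (rule polyfuns.mult[OF polyfuns.const polyfuns_rho[OF G.inv_closed[OF u] q(1)]])
  then show "\<exists>q\<in>polyfuns scale. \<forall>v. p (inv\<^bsub>W\<^esub> u \<otimes>\<^bsub>W\<^esub> w) (\<rho> (inv\<^bsub>W\<^esub> u) v)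
      - p (inv\<^bsub>W\<^esub> u \<otimes>\<^bsub>W\<^esub> (\<sigma> H \<otimes>\<^bsub>W\<^esub> w)) (\<rho> (inv\<^bsub>W\<^esub> u) v) = \<alpha> H v ^ m H * q v"
    by (rule bexI[rotated]) (simp add: q(2)[unfolded shift] c mH power_mult_distrib)
qed

text \<open>The division by the form is carried out on all of V, so that the congruences for the
  quotient \<open>g\<close> make sense on the hyperplanes too.\<close>

lemma quasi_covariant_family_nabla:
  assumes m: "m \<in> multiplicities scale W \<rho>" and H: "H \<in> \<A>" and odd: "odd (m H)"
    and p: "quasi_covariant_family m p"
  obtains g where "quasi_covariant_family m g"
    "\<And>w v. w \<in> carrier W \<Longrightarrow> p w v - p (\<sigma> H \<otimes>\<^bsub>W\<^esub> w) (\<rho> (\<sigma> H) v) = \<alpha> H v * g w v"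
proof -
  define G where "G w v = p w v - p (\<sigma> H \<otimes>\<^bsub>W\<^esub> w) (\<rho> (\<sigma> H) v)" for w v
  \<comment> \<open>\<open>G\<close> is \<open>p\<close> minus its translate by
    \<open>\<sigma> H\<close>, which is its own inverse.\<close>
  have G: "quasi_covariant_family m G"
    using quasi_covariant_family_diff[OF p quasi_covariant_family_translate[OF m refl_carrier[OF H] p]] H
    by (simp add: G_def[abs_def])
  have "\<exists>g\<in>polyfuns scale. \<forall>v. G w v = \<alpha> H v * g v" if w: "w \<in> carrier W" for w
  proof -
    obtain q where q: "\<And>v. p w v - p (\<sigma> H \<otimes>\<^bsub>W\<^esub> w) v = \<alpha> H v ^ m H * q v"
      using quasi_covariant_family_congruence[OF p H w] by blast
    have "G w v = 0" if "v \<in> H" for v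
    proof -
      have "\<rho> (\<sigma> H) v = v" "\<alpha> H v = 0"
        using that refl_fixed[OF H] form_eq_0_iff[OF H] by auto
      moreover have "m H \<noteq> 0"
        using odd by (intro notI) simp
      ultimately show ?thesis
        using q[of v] by (simp add: G_def)
    qed
    then show ?thesis
      using form_dvd[OF H quasi_covariant_family_polyfuns[OF G w]] by metis
  qed
  then obtain g where g: "\<And>w. w \<in> carrier W \<Longrightarrow> g w \<in> polyfuns scale"
    "\<And>w v. w \<in> carrier W \<Longrightarrow> G w v = \<alpha> H v * g w v"
    by metis
  have "quasi_covariant_family m g"
  proof (rule quasi_covariant_familyI)
    fix H' w assume H': "H' \<in> \<A>" and w: "w \<in> carrier W"
    define w' where "w' = \<sigma> H' \<otimes>\<^bsub>W\<^esub> w"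
    have w': "w' \<in> carrier W"
      using H' w by (simp add: w'_def refl_carrier)
    \<comment> \<open>It suffices to split a factor \<open>\<alpha> H\<close>, besides the power of
      \<open>\<alpha> H'\<close>, off the difference of the numerators; each of the two cases below
      supplies it.\<close>
    have cancel: "g w v - g w' v = \<alpha> H' v ^ m H' * q v"
      if q: "q \<in> polyfuns scale" and eq: "\<And>v. G w v - G w' v = \<alpha> H v * (\<alpha> H' v ^ m H' * q v)" for q v
    proof (rule form_cancel[OF H])
      show "(\<lambda>v. g w v - g w' v) \<in> polyfuns scale"
        using g(1) w w' by (intro polyfuns_diff)
      show "(\<lambda>v. \<alpha> H' v ^ m H' * q v) \<in> polyfuns scale"
        by (intro polyfuns.mult polyfuns_power polyfuns.form form_linear H' q)
      show "\<alpha> H v * (g w v - g w' v) = \<alpha> H v * (\<alpha> H' v ^ m H' * q v)" for v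
        using eq[of v] by (simp add: g(2) w w' right_diff_distrib)
    qed
    have "\<exists>q\<in>polyfuns scale. \<forall>v. G w v - G w' v = \<alpha> H v * (\<alpha> H' v ^ m H' * q v)"
    proof (cases "H' = H")
      case True
      obtain q where q: "q \<in> polyfuns scale" "\<And>v. p w v - p w' v = \<alpha> H v ^ m H * q v"
        using quasi_covariant_family_congruence[OF p H w] unfolding w'_def True by blast
      have "\<sigma> H \<otimes>\<^bsub>W\<^esub> w' = w"
        using H w by (simp add: w'_def True refl_carrier flip: G.m_assoc)
      \<comment> \<open>Left multiplication by \<open>\<sigma> H\<close> swaps \<open>w\<close> and
        \<open>w'\<close>, so the terms at \<open>v\<close> and those at the reflected point each
        form a difference covered by the congruence for \<open>p\<close>.\<close>
      then have "G w v - G w' v = (p w v - p w' v) + (p w (\<rho> (\<sigma> H) v) - p w' (\<rho> (\<sigma> H) v))" for v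
        by (simp add: G_def w'_def True)
      \<comment> \<open>At the reflected point the odd power of \<open>\<alpha> H\<close> changes
        sign, which turns the sum into a difference of values of \<open>q\<close>.\<close>
      then have "G w v - G w' v = \<alpha> H v ^ m H * (q v - q (\<rho> (\<sigma> H) v))" for v
        using odd by (simp add: q(2) form_refl[OF H] power_minus_odd right_diff_distrib)
      moreover have "q v - q (\<rho> (\<sigma> H) v) = 0" if "v \<in> H" for v
      proof -
        have "\<rho> (\<sigma> H) v = v"
          using that refl_fixed[OF H] by blast
        then show ?thesis by simp
      qed
      then obtain r where "r \<in> polyfuns scale" "\<And>v. q v - q (\<rho> (\<sigma> H) v) = \<alpha> H v * r v"
        using form_dvd[OF H polyfuns_diff[OF q(1) polyfuns_rho[OF refl_carrier[OF H] q(1)]]] by blast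
      ultimately show ?thesis
        by (auto simp: True)
    next
      case False
      obtain r where r: "r \<in> polyfuns scale" "\<And>v. G w v - G w' v = \<alpha> H' v ^ m H' * r v"
        using quasi_covariant_family_congruence[OF G H' w] unfolding w'_def by blast
      \<comment> \<open>The left side is a multiple of \<open>\<alpha> H\<close>, so by coprimality
        the missing factor must sit in \<open>r\<close>.\<close>
      have eq: "\<alpha> H v * (g w v - g w' v) = \<alpha> H' v ^ m H' * r v" for v
        using r(2)[of v] by (simp add: g(2) w w' right_diff_distrib)
      obtain q where "q \<in> polyfuns scale" "\<And>v. r v = \<alpha> H v * q v"
        using form_coprime[OF H H' False[symmetric] r(1) eq] by blast
      then show ?thesis
        using r(2) by (auto simp: mult.left_commute)
    qed
    then show "\<exists>q\<in>polyfuns scale. \<forall>v. g w v - g (\<sigma> H' \<otimes>\<^bsub>W\<^esub> w) v = \<alpha> H' v ^ m H' * q v"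
      using cancel unfolding w'_def by blast
  qed (rule g(1))
  then show ?thesis
    using that g(2) by (simp add: G_def)
qed

section \<open>Regular functions\<close>

abbreviation "disc v \<equiv> \<Prod>H\<in>\<A>. \<alpha> H v"

lemma vreg_iff: "v \<in> vreg scale W \<rho> \<longleftrightarrow> (\<forall>H\<in>\<A>. \<alpha> H v \<noteq> 0)"
  using form_eq_0_iff by (auto simp: vreg_def)

lemma disc_nonzero: "v \<in> vreg scale W \<rho> \<Longrightarrow> disc v \<noteq> 0"
  using finite_arrangement by (simp add: vreg_iff)

lemma disc_polyfuns: "(\<lambda>v. disc v) \<in> polyfuns scale"
  by (intro polyfuns_prod polyfuns.form form_linear)

lemma vreg_rho [simp]:
  assumes "w \<in> carrier W"
  shows "\<rho> w v \<in> vreg scale W \<rho> \<longleftrightarrow> v \<in> vreg scale W \<rho>"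
proof -
  have imp: "\<rho> w v \<in> vreg scale W \<rho>" if "v \<in> vreg scale W \<rho>" "w \<in> carrier W" for w v
  proof (rule ccontr)
    assume "\<rho> w v \<notin> vreg scale W \<rho>"
    then obtain H where "H \<in> \<A>" "\<rho> w v \<in> H"
      by (auto simp: vreg_def)
    then have "\<rho> (inv\<^bsub>W\<^esub> w) ` H \<in> \<A>" "v \<in> \<rho> (inv\<^bsub>W\<^esub> w) ` H"
      using that arrangement_image[of H "inv\<^bsub>W\<^esub> w"] by (auto intro!: image_eqI[of v _ "\<rho> w v"])
    then show False
      using that(1) by (auto simp: vreg_def)
  qed
  show ?thesis
    using imp[of v w] imp[of "\<rho> w v" "inv\<^bsub>W\<^esub> w"] assms by auto
qed

text \<open>The group permutes the hyperplanes, so \<open>disc\<close> changes only by the product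
  of the proportionality constants of the forms. Translation therefore preserves denominators that
  are powers of \<open>disc\<close>.\<close>

lemma disc_translate:
  assumes w: "w \<in> carrier W"
  obtains c where "c \<noteq> 0" "\<And>v. disc (\<rho> (inv\<^bsub>W\<^esub> w) v) = c * disc v"
proof -
  have "\<forall>H\<in>\<A>. \<exists>c. c \<noteq> 0 \<and> (\<forall>v. \<alpha> H (\<rho> (inv\<^bsub>W\<^esub> w) v) = c * \<alpha> (\<rho> w ` H) v)"
    using form_translate[OF _ w] by metis
  then obtain c where c: "\<And>H. H \<in> \<A> \<Longrightarrow> c H \<noteq> 0"
    "\<And>H v. H \<in> \<A> \<Longrightarrow> \<alpha> H (\<rho> (inv\<^bsub>W\<^esub> w) v) = c H * \<alpha> (\<rho> w ` H) v"
    by metis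
  have bij: "bij_betw (\<lambda>H. \<rho> w ` H) \<A> \<A>"
  proof (rule bij_betwI[where g = "\<lambda>H. \<rho> (inv\<^bsub>W\<^esub> w) ` H"])
    show "(\<lambda>H. \<rho> w ` H) \<in> \<A> \<rightarrow> \<A>" "(\<lambda>H. \<rho> (inv\<^bsub>W\<^esub> w) ` H) \<in> \<A> \<rightarrow> \<A>"
      using w by (auto intro: arrangement_image)
  qed (use w in \<open>auto simp: image_image\<close>)
  have "disc (\<rho> (inv\<^bsub>W\<^esub> w) v) = (\<Prod>H\<in>\<A>. c H) * disc v" for v
  proof -
    have "disc (\<rho> (inv\<^bsub>W\<^esub> w) v) = (\<Prod>H\<in>\<A>. c H * \<alpha> (\<rho> w ` H) v)"
      by (rule prod.cong) (auto simp: c)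
    also have "\<dots> = (\<Prod>H\<in>\<A>. c H) * (\<Prod>H\<in>\<A>. \<alpha> (\<rho> w ` H) v)"
      by (rule prod.distrib)
    also have "(\<Prod>H\<in>\<A>. \<alpha> (\<rho> w ` H) v) = disc v"
      by (rule prod.reindex_bij_betw[OF bij])
    finally show ?thesis .
  qed
  then show ?thesis
    using that[of "\<Prod>H\<in>\<A>. c H"] c(1) finite_arrangement by simp
qed

text \<open>V_reg is dense: if \<open>f - g\<close> were nonzero somewhere, it would be nonzero at a
  point where \<open>disc\<close> is nonzero as well.\<close>

lemma res_polyfuns_inj:
  assumes "f \<in> polyfuns scale" "g \<in> polyfuns scale" "rst f = rst g"
  shows "f = g"
proof (rule ccontr)
  assume "f \<noteq> g"
  then obtain a where a: "f a - g a \<noteq> 0"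
    by (auto simp: fun_eq_iff)
  obtain b where b: "disc b \<noteq> 0"
    using polyfuns_prod_nonzero[OF vector_space_axioms finite_arrangement, of \<alpha>]
      polyfuns.form[OF form_linear] form_nonzero by metis
  obtain t where t: "f (a + scale t (b - a)) - g (a + scale t (b - a)) \<noteq> 0"
    "disc (a + scale t (b - a)) \<noteq> 0"
    using polyfuns_common_nonzero[OF vector_space_axioms polyfuns_diff[OF assms(1,2)] disc_polyfuns a b] .
  have "a + scale t (b - a) \<in> vreg scale W \<rho>"
    using t(2) finite_arrangement by (simp add: vreg_iff)
  with fun_cong[OF assms(3), of "a + scale t (b - a)"] t(1) show False
    by (simp add: res_def)
qed

abbreviation "\<O> \<equiv> regfuns scale W \<rho> \<alpha>"

lemma regfunsI:
  assumes "p \<in> polyfuns scale" "\<And>v. v \<in> vreg scale W \<rho> \<Longrightarrow> f v = p v / disc v ^ n"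
    "\<And>v. v \<notin> vreg scale W \<rho> \<Longrightarrow> f v = 0"
  shows "f \<in> \<O>"
proof -
  have "f = rst (\<lambda>v. p v / disc v ^ n)"
    using assms(2,3) by (auto simp: res_def)
  then show ?thesis
    using assms(1) by (auto simp: regfuns_def)
qed

lemma regfunsE:
  assumes "f \<in> \<O>"
  obtains p n where "p \<in> polyfuns scale" "\<And>v. v \<in> vreg scale W \<rho> \<Longrightarrow> f v = p v / disc v ^ n"
    "\<And>v. v \<notin> vreg scale W \<rho> \<Longrightarrow> f v = 0"
proof -
  obtain p n where "p \<in> polyfuns scale" "f = rst (\<lambda>v. p v / disc v ^ n)"
    using assms by (auto simp: regfuns_def)
  then show ?thesis
    using that[of p n] by (simp add: res_def)
qed

lemma regfuns_outside: "f \<in> \<O> \<Longrightarrow> v \<notin> vreg scale W \<rho> \<Longrightarrow> f v = 0"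
  by (erule regfunsE)

lemma regfuns_res: "p \<in> polyfuns scale \<Longrightarrow> rst p \<in> \<O>"
  by (rule regfunsI[where n = 0]) (auto simp: res_def)

lemma regfuns_zero: "(\<lambda>_. 0) \<in> \<O>"
  by (rule regfunsI[where n = 0, OF polyfuns.const[of 0]]) auto

lemma regfuns_add:
  assumes "f \<in> \<O>" "g \<in> \<O>"
  shows "(\<lambda>v. f v + g v) \<in> \<O>"
proof -
  obtain p n where f: "p \<in> polyfuns scale" "\<And>v. v \<in> vreg scale W \<rho> \<Longrightarrow> f v = p v / disc v ^ n"
    "\<And>v. v \<notin> vreg scale W \<rho> \<Longrightarrow> f v = 0"
    using regfunsE[OF assms(1)] by metis
  obtain q l where g: "q \<in> polyfuns scale" "\<And>v. v \<in> vreg scale W \<rho> \<Longrightarrow> g v = q v / disc v ^ l"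
    "\<And>v. v \<notin> vreg scale W \<rho> \<Longrightarrow> g v = 0"
    using regfunsE[OF assms(2)] by metis
  show ?thesis
  proof (rule regfunsI[where n = "n + l"])
    show "(\<lambda>v. p v * disc v ^ l + q v * disc v ^ n) \<in> polyfuns scale"
      by (intro polyfuns.add polyfuns.mult polyfuns_power disc_polyfuns f g)
    fix v assume v: "v \<in> vreg scale W \<rho>"
    then have "disc v ^ n \<noteq> 0" "disc v ^ l \<noteq> 0"
      using disc_nonzero by simp_all
    then show "f v + g v = (p v * disc v ^ l + q v * disc v ^ n) / disc v ^ (n + l)"
      unfolding f(2)[OF v] g(2)[OF v] power_add
      by (subst add_frac_eq) (simp_all only: mult.commute not_False_eq_True)
  qed (simp add: f g)
qed

lemma regfuns_mult:
  assumes "f \<in> \<O>" "g \<in> \<O>"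
  shows "(\<lambda>v. f v * g v) \<in> \<O>"
proof -
  obtain p n where f: "p \<in> polyfuns scale" "\<And>v. v \<in> vreg scale W \<rho> \<Longrightarrow> f v = p v / disc v ^ n"
    "\<And>v. v \<notin> vreg scale W \<rho> \<Longrightarrow> f v = 0"
    using regfunsE[OF assms(1)] by metis
  obtain q l where g: "q \<in> polyfuns scale" "\<And>v. v \<in> vreg scale W \<rho> \<Longrightarrow> g v = q v / disc v ^ l"
    "\<And>v. v \<notin> vreg scale W \<rho> \<Longrightarrow> g v = 0"
    using regfunsE[OF assms(2)] by metis
  show ?thesis
    by (rule regfunsI[where n = "n + l", OF polyfuns.mult[OF f(1) g(1)]])
      (simp_all only: f g power_add times_divide_times_eq mult_zero_left not_False_eq_True)
qed

lemma regfuns_uminus: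
  assumes "f \<in> \<O>"
  shows "(\<lambda>v. - f v) \<in> \<O>"
proof -
  obtain p n where f: "p \<in> polyfuns scale" "\<And>v. v \<in> vreg scale W \<rho> \<Longrightarrow> f v = p v / disc v ^ n"
    "\<And>v. v \<notin> vreg scale W \<rho> \<Longrightarrow> f v = 0"
    using regfunsE[OF assms(1)] by metis
  show ?thesis
    by (rule regfunsI[OF polyfuns_uminus[OF f(1)], of _ n]) (simp_all add: f)
qed

lemma regfuns_sum:
  assumes "\<And>i. i \<in> I \<Longrightarrow> f i \<in> \<O>"
  shows "(\<lambda>v. \<Sum>i\<in>I. f i v) \<in> \<O>"
  using assms by (induction I rule: infinite_finite_induct) (auto intro: regfuns_zero regfuns_add)

lemma regfuns_translate:
  assumes "f \<in> \<O>" and w: "w \<in> carrier W"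
  shows "(\<lambda>v. f (\<rho> (inv\<^bsub>W\<^esub> w) v)) \<in> \<O>"
proof -
  obtain p n where f: "p \<in> polyfuns scale" "\<And>v. v \<in> vreg scale W \<rho> \<Longrightarrow> f v = p v / disc v ^ n"
    "\<And>v. v \<notin> vreg scale W \<rho> \<Longrightarrow> f v = 0"
    using regfunsE[OF assms(1)] by metis
  obtain c where c: "c \<noteq> 0" "\<And>v. disc (\<rho> (inv\<^bsub>W\<^esub> w) v) = c * disc v"
    using disc_translate[OF w] by blast
  show ?thesis
  proof (rule regfunsI[where n = n])
    show "(\<lambda>v. 1 / c ^ n * p (\<rho> (inv\<^bsub>W\<^esub> w) v)) \<in> polyfuns scale"
      using w by (intro polyfuns.mult polyfuns.const polyfuns_rho f) simp
    show "f (\<rho> (inv\<^bsub>W\<^esub> w) v) = 1 / c ^ n * p (\<rho> (inv\<^bsub>W\<^esub> w) v) / disc v ^ n"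
      if "v \<in> vreg scale W \<rho>" for v
    proof -
      have "f (\<rho> (inv\<^bsub>W\<^esub> w) v) = p (\<rho> (inv\<^bsub>W\<^esub> w) v) / disc (\<rho> (inv\<^bsub>W\<^esub> w) v) ^ n"
        using that w by (intro f(2)) simp
      then show ?thesis
        unfolding c(2) power_mult_distrib by simp
    qed
  qed (use w f(3) in simp)
qed

text \<open>Elements of \<open>\<O>\<close> have powers of \<open>disc\<close> as denominators, so
  the fraction is expanded by the product of the other forms.\<close>

lemma regfuns_inverse_form:
  assumes "H \<in> \<A>"
  shows "rst (\<lambda>v. 1 / \<alpha> H v) \<in> \<O>"
proof (rule regfunsI[where n = 1])
  show "(\<lambda>v. \<Prod>H'\<in>\<A> - {H}. \<alpha> H' v) \<in> polyfuns scale"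
    by (intro polyfuns_prod polyfuns.form form_linear) simp
  fix v assume v: "v \<in> vreg scale W \<rho>"
  have "disc v = \<alpha> H v * (\<Prod>H'\<in>\<A> - {H}. \<alpha> H' v)"
    by (rule prod.remove[OF finite_arrangement assms])
  then show "rst (\<lambda>v. 1 / \<alpha> H v) v = (\<Prod>H'\<in>\<A> - {H}. \<alpha> H' v) / disc v ^ 1"
    using disc_nonzero[OF v] v by (simp add: res_def)
qed (simp add: res_def)

section \<open>The crossed product\<close>

abbreviation "\<T> \<equiv> tensor_space scale W \<rho> \<alpha>"
abbreviation "act \<equiv> twisted_act W \<rho>"

lemma tensor_space_iff:
  "F \<in> \<T> \<longleftrightarrow> (\<forall>w\<in>carrier W. F w \<in> \<O>) \<and> (\<forall>w. w \<notin> carrier W \<longrightarrow> F w = (\<lambda>_. 0))"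
proof
  assume F: "(\<forall>w\<in>carrier W. F w \<in> \<O>) \<and> (\<forall>w. w \<notin> carrier W \<longrightarrow> F w = (\<lambda>_. 0))"
  then have "F = families W F"
    by (auto simp: families_def)
  with F show "F \<in> \<T>"
    by (auto simp: tensor_space_def)
qed (auto simp: tensor_space_def families_def)

lemma tensor_space_regfuns: "F \<in> \<T> \<Longrightarrow> F w \<in> \<O>"
  using regfuns_zero by (cases "w \<in> carrier W") (auto simp: tensor_space_iff)

lemma tensor_space_off_carrier: "F \<in> \<T> \<Longrightarrow> w \<notin> carrier W \<Longrightarrow> F w v = 0"
  by (simp add: tensor_space_iff)

lemma tensor_space_off_vreg: "F \<in> \<T> \<Longrightarrow> v \<notin> vreg scale W \<rho> \<Longrightarrow> F w v = 0"
  by (rule regfuns_outside[OF tensor_space_regfuns])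

text \<open>For given \<open>w\<close> and \<open>x\<close> a single \<open>u\<close> contributes to
  the inner sum. The resulting convolution formula is the working form of the action.\<close>

lemma act_eq:
  assumes "x \<in> carrier W"
  shows "act A F x v = (\<Sum>w\<in>carrier W. A w v * F (inv\<^bsub>W\<^esub> w \<otimes>\<^bsub>W\<^esub> x) (\<rho> (inv\<^bsub>W\<^esub> w) v))"
  unfolding twisted_act_def
proof (rule sum.cong[OF refl])
  fix w assume w: "w \<in> carrier W"
  have "w \<otimes>\<^bsub>W\<^esub> u = x \<longleftrightarrow> u = inv\<^bsub>W\<^esub> w \<otimes>\<^bsub>W\<^esub> x" if "u \<in> carrier W" for u
    using w that assms by (metis G.inv_closed G.inv_solve_left)
  then have "(\<Sum>u\<in>carrier W. if w \<otimes>\<^bsub>W\<^esub> u = x then A w v * fun_act W \<rho> w (F u) v else 0)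
    = (\<Sum>u\<in>carrier W. if u = inv\<^bsub>W\<^esub> w \<otimes>\<^bsub>W\<^esub> x then A w v * fun_act W \<rho> w (F u) v else 0)"
    by (intro sum.cong) auto
  also have "\<dots> = A w v * F (inv\<^bsub>W\<^esub> w \<otimes>\<^bsub>W\<^esub> x) (\<rho> (inv\<^bsub>W\<^esub> w) v)"
    using w assms finite_W by (simp add: fun_act_def)
  finally show "(\<Sum>u\<in>carrier W. if w \<otimes>\<^bsub>W\<^esub> u = x then A w v * fun_act W \<rho> w (F u) v else 0)
    = A w v * F (inv\<^bsub>W\<^esub> w \<otimes>\<^bsub>W\<^esub> x) (\<rho> (inv\<^bsub>W\<^esub> w) v)" .
qed

lemma act_off_carrier:
  assumes "x \<notin> carrier W"
  shows "act A F x v = 0"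
  unfolding twisted_act_def using assms by (intro sum.neutral ballI) auto

lemma act_eqI:
  assumes "\<And>x v. x \<in> carrier W \<Longrightarrow> act A F x v = G x v"
    and "\<And>x v. x \<notin> carrier W \<Longrightarrow> G x v = 0"
  shows "act A F = G"
proof (intro ext)
  show "act A F x v = G x v" for x v
    using assms by (cases "x \<in> carrier W") (auto simp: act_off_carrier)
qed

text \<open>Product and action are given by the same formula, so this identity is both the
  associativity of the crossed product and the associativity law of the module.\<close>

lemma act_assoc: "act (act A B) F = act A (act B F)"
proof (rule act_eqI)
  fix x v assume x: "x \<in> carrier W"
  have "act (act A B) F x v = (\<Sum>w\<in>carrier W. \<Sum>u\<in>carrier W. A u v *
      B (inv\<^bsub>W\<^esub> u \<otimes>\<^bsub>W\<^esub> w) (\<rho> (inv\<^bsub>W\<^esub> u) v) * F (inv\<^bsub>W\<^esub> w \<otimes>\<^bsub>W\<^esub> x) (\<rho> (inv\<^bsub>W\<^esub> w) v))"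
    using x by (simp add: act_eq sum_distrib_right)
  also have "\<dots> = (\<Sum>u\<in>carrier W. \<Sum>w\<in>carrier W. A u v *
      B (inv\<^bsub>W\<^esub> u \<otimes>\<^bsub>W\<^esub> w) (\<rho> (inv\<^bsub>W\<^esub> u) v) * F (inv\<^bsub>W\<^esub> w \<otimes>\<^bsub>W\<^esub> x) (\<rho> (inv\<^bsub>W\<^esub> w) v))"
    by (rule sum.swap)
  also have "\<dots> = (\<Sum>u\<in>carrier W. A u v * act B F (inv\<^bsub>W\<^esub> u \<otimes>\<^bsub>W\<^esub> x) (\<rho> (inv\<^bsub>W\<^esub> u) v))"
  proof (rule sum.cong[OF refl])
    fix u assume u: "u \<in> carrier W"
    have "(\<Sum>w\<in>carrier W. A u v * B (inv\<^bsub>W\<^esub> u \<otimes>\<^bsub>W\<^esub> w) (\<rho> (inv\<^bsub>W\<^esub> u) v)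
        * F (inv\<^bsub>W\<^esub> w \<otimes>\<^bsub>W\<^esub> x) (\<rho> (inv\<^bsub>W\<^esub> w) v))
      = (\<Sum>y\<in>carrier W. A u v * (B y (\<rho> (inv\<^bsub>W\<^esub> u) v)
        * F (inv\<^bsub>W\<^esub> y \<otimes>\<^bsub>W\<^esub> (inv\<^bsub>W\<^esub> u \<otimes>\<^bsub>W\<^esub> x)) (\<rho> (inv\<^bsub>W\<^esub> y) (\<rho> (inv\<^bsub>W\<^esub> u) v))))"
    \<comment> \<open>The substitution is \<open>w = u y\<close>; the inverse of \<open>w\<close>
      then acts as the inverse of \<open>u\<close> followed by the inverse of
      \<open>y\<close>.\<close>
    proof (rule sum.reindex_bij_witness[where i = "\<lambda>y. u \<otimes>\<^bsub>W\<^esub> y" and j = "\<lambda>w. inv\<^bsub>W\<^esub> u \<otimes>\<^bsub>W\<^esub> w"])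
      fix w assume w: "w \<in> carrier W"
      have "inv\<^bsub>W\<^esub> (inv\<^bsub>W\<^esub> u \<otimes>\<^bsub>W\<^esub> w) \<otimes>\<^bsub>W\<^esub> (inv\<^bsub>W\<^esub> u \<otimes>\<^bsub>W\<^esub> x) = inv\<^bsub>W\<^esub> w \<otimes>\<^bsub>W\<^esub> x"
      proof -
        have "u \<otimes>\<^bsub>W\<^esub> (inv\<^bsub>W\<^esub> u \<otimes>\<^bsub>W\<^esub> x) = x"
          using u x by (simp flip: G.m_assoc)
        then show ?thesis
          using u w x by (simp add: G.inv_mult_group G.m_assoc)
      qed
      moreover have "\<rho> (inv\<^bsub>W\<^esub> (inv\<^bsub>W\<^esub> u \<otimes>\<^bsub>W\<^esub> w)) (\<rho> (inv\<^bsub>W\<^esub> u) v) = \<rho> (inv\<^bsub>W\<^esub> w) v"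
        using u w by (simp add: G.inv_mult_group)
      ultimately show "A u v * (B (inv\<^bsub>W\<^esub> u \<otimes>\<^bsub>W\<^esub> w) (\<rho> (inv\<^bsub>W\<^esub> u) v)
        * F (inv\<^bsub>W\<^esub> (inv\<^bsub>W\<^esub> u \<otimes>\<^bsub>W\<^esub> w) \<otimes>\<^bsub>W\<^esub> (inv\<^bsub>W\<^esub> u \<otimes>\<^bsub>W\<^esub> x))
            (\<rho> (inv\<^bsub>W\<^esub> (inv\<^bsub>W\<^esub> u \<otimes>\<^bsub>W\<^esub> w)) (\<rho> (inv\<^bsub>W\<^esub> u) v)))
        = A u v * B (inv\<^bsub>W\<^esub> u \<otimes>\<^bsub>W\<^esub> w) (\<rho> (inv\<^bsub>W\<^esub> u) v)
          * F (inv\<^bsub>W\<^esub> w \<otimes>\<^bsub>W\<^esub> x) (\<rho> (inv\<^bsub>W\<^esub> w) v)"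
        by simp
    qed (use u in \<open>simp_all flip: G.m_assoc\<close>)
    then show "(\<Sum>w\<in>carrier W. A u v * B (inv\<^bsub>W\<^esub> u \<otimes>\<^bsub>W\<^esub> w) (\<rho> (inv\<^bsub>W\<^esub> u) v)
        * F (inv\<^bsub>W\<^esub> w \<otimes>\<^bsub>W\<^esub> x) (\<rho> (inv\<^bsub>W\<^esub> w) v))
      = A u v * act B F (inv\<^bsub>W\<^esub> u \<otimes>\<^bsub>W\<^esub> x) (\<rho> (inv\<^bsub>W\<^esub> u) v)"
      using u x by (simp add: act_eq sum_distrib_left)
  qed
  also have "\<dots> = act A (act B F) x v"
    using x by (simp add: act_eq)
  finally show "act (act A B) F x v = act A (act B F) x v" .
qed (rule act_off_carrier)

lemma act_add_left: "act (\<lambda>w v. A w v + B w v) F = (\<lambda>w v. act A F w v + act B F w v)"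
  by (rule act_eqI) (simp_all add: act_eq act_off_carrier sum.distrib distrib_right)

lemma act_add_right: "act A (\<lambda>w v. F w v + G w v) = (\<lambda>w v. act A F w v + act A G w v)"
  by (rule act_eqI) (simp_all add: act_eq act_off_carrier sum.distrib distrib_left)

lemma act_uminus_left: "act (\<lambda>w v. - A w v) F = (\<lambda>w v. - act A F w v)"
  by (rule act_eqI) (simp_all add: act_eq act_off_carrier sum_negf)

lemma act_closed:
  assumes "A \<in> \<T>" "F \<in> \<T>"
  shows "act A F \<in> \<T>"
  unfolding tensor_space_iff
proof (intro conjI ballI allI impI ext)
  fix x assume x: "x \<in> carrier W"
  then show "act A F x \<in> \<O>"
    unfolding act_eq[OF x, abs_def]
    by (intro regfuns_sum regfuns_mult regfuns_translate tensor_space_regfuns assms)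
qed (rule act_off_carrier)

lemma act_single:
  assumes "u \<in> carrier W"
  shows "act (single u f) F = families W (\<lambda>x v. f v * F (inv\<^bsub>W\<^esub> u \<otimes>\<^bsub>W\<^esub> x) (\<rho> (inv\<^bsub>W\<^esub> u) v))"
proof (rule act_eqI)
  fix x v assume x: "x \<in> carrier W"
  have "act (single u f) F x v = (\<Sum>w\<in>carrier W. if w = u
      then f v * F (inv\<^bsub>W\<^esub> u \<otimes>\<^bsub>W\<^esub> x) (\<rho> (inv\<^bsub>W\<^esub> u) v) else 0)"
    unfolding act_eq[OF x] by (rule sum.cong) (auto simp: single_def)
  then show "act (single u f) F x v
      = families W (\<lambda>x v. f v * F (inv\<^bsub>W\<^esub> u \<otimes>\<^bsub>W\<^esub> x) (\<rho> (inv\<^bsub>W\<^esub> u) v)) x v"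
    using x assms finite_W by (simp add: families_def)
qed (simp add: families_def)

text \<open>The unit carries the constant 1 cut off outside V_reg, so it acts as the identity only
  on families supported on the carrier and on V_reg.\<close>

lemma act_one_left:
  assumes "F \<in> \<T>"
  shows "act (single \<one>\<^bsub>W\<^esub> (rst (\<lambda>_. 1))) F = F"
  using tensor_space_off_carrier[OF assms] tensor_space_off_vreg[OF assms]
  by (auto simp: act_single families_def res_def fun_eq_iff)

lemma act_one_right:
  assumes "F \<in> \<T>"
  shows "act F (single \<one>\<^bsub>W\<^esub> (rst (\<lambda>_. 1))) = F"
proof (rule act_eqI)
  fix x v assume x: "x \<in> carrier W"
  have "inv\<^bsub>W\<^esub> w \<otimes>\<^bsub>W\<^esub> x = \<one>\<^bsub>W\<^esub> \<longleftrightarrow> w = x" if "w \<in> carrier W" for w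
    using that x by (metis G.inv_closed G.inv_equality G.inv_inv G.l_inv)
  then have "act F (single \<one>\<^bsub>W\<^esub> (rst (\<lambda>_. 1))) x v = (\<Sum>w\<in>carrier W. if w = x then F x v else 0)"
    unfolding act_eq[OF x] using tensor_space_off_vreg[OF assms]
    by (intro sum.cong) (auto simp: single_def res_def)
  then show "act F (single \<one>\<^bsub>W\<^esub> (rst (\<lambda>_. 1))) x v = F x v"
    using x finite_W by simp
qed (rule tensor_space_off_carrier[OF assms])

lemma single_closed: "u \<in> carrier W \<Longrightarrow> f \<in> \<O> \<Longrightarrow> single u f \<in> \<T>"
  using regfuns_zero by (auto simp: tensor_space_iff single_def)

lemma tensor_space_zero: "(\<lambda>_ _. 0) \<in> \<T>"
  using regfuns_zero by (simp add: tensor_space_iff)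

lemma tensor_space_add: "F \<in> \<T> \<Longrightarrow> G \<in> \<T> \<Longrightarrow> (\<lambda>w v. F w v + G w v) \<in> \<T>"
  using regfuns_add by (simp add: tensor_space_iff)

lemma tensor_space_uminus: "F \<in> \<T> \<Longrightarrow> (\<lambda>w v. - F w v) \<in> \<T>"
  using regfuns_uminus by (simp add: tensor_space_iff)

abbreviation "CP \<equiv> crossed_product scale W \<rho> \<alpha>"

lemma crossed_product_simps [simp]:
  "carrier CP = \<T>" "monoid.mult CP = act" "one CP = single \<one>\<^bsub>W\<^esub> (rst (\<lambda>_. 1))"
  "ring.zero CP = (\<lambda>_ _. 0)" "ring.add CP = (\<lambda>A B w v. A w v + B w v)"
  by (simp_all add: crossed_product_def)

sublocale CP: ring CP
proof (rule ringI)
  show "abelian_group CP"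
  proof (rule abelian_groupI)
    show "\<exists>y\<in>carrier CP. y \<oplus>\<^bsub>CP\<^esub> x = \<zero>\<^bsub>CP\<^esub>" if "x \<in> carrier CP" for x
      using that by (intro bexI[of _ "\<lambda>w v. - x w v"]) (simp_all add: tensor_space_uminus)
  qed (simp_all add: tensor_space_zero tensor_space_add ac_simps)
  show "monoid CP"
    by (rule monoidI) (simp_all add: act_closed act_assoc act_one_left act_one_right single_closed
        regfuns_res polyfuns.const)
qed (simp_all add: act_add_left act_add_right)

lemma a_inv_crossed_product: "A \<in> \<T> \<Longrightarrow> \<ominus>\<^bsub>CP\<^esub> A = (\<lambda>w v. - A w v)"
  by (rule CP.minus_equality) (simp_all add: tensor_space_uminus)

section \<open>Divided difference elements and their action\<close>

abbreviation "nabla \<equiv> nabla_elt scale W \<rho> \<alpha>"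

text \<open>Associativity and additivity split the action of the ring element into its factors:
  translate by the reflection, subtract, and divide by the form. Outside V_reg both sides are
  zero.\<close>

lemma
  assumes "H \<in> \<A>"
  shows nabla_elt_closed: "nabla H \<in> \<T>"
    and act_nabla_elt: "F \<in> \<T> \<Longrightarrow> act (nabla H) F = nabla_op scale W \<rho> \<alpha> H F"
proof -
  define a where "a = single \<one>\<^bsub>W\<^esub> (rst (\<lambda>v. 1 / \<alpha> H v))"
  define s where "s = single (\<sigma> H) (rst (\<lambda>_. 1))"
  define e where "e = single \<one>\<^bsub>W\<^esub> (rst (\<lambda>_. 1))"
  have a: "a \<in> \<T>"
    unfolding a_def by (rule single_closed[OF _ regfuns_inverse_form[OF assms]]) simp
  have s: "s \<in> \<T>"
    unfolding s_def by (intro single_closed regfuns_res polyfuns.const refl_carrier assms)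
  have e: "e \<in> \<T>"
    unfolding e_def by (intro single_closed regfuns_res polyfuns.const G.one_closed)
  have nabla: "nabla H = act a (\<lambda>w v. e w v + - s w v)"
    using a_inv_crossed_product[OF s]
    by (simp add: nabla_elt_def Let_def a_minus_def fun_elt_def grp_elt_def a_def s_def e_def)
  show "nabla H \<in> \<T>"
    unfolding nabla by (intro act_closed tensor_space_add tensor_space_uminus a s e)
  assume F: "F \<in> \<T>"
  have "act (nabla H) F = act a (\<lambda>w v. F w v + - act s F w v)"
    unfolding nabla act_assoc act_add_left act_uminus_left e_def act_one_left[OF F] ..
  also have "\<dots> = nabla_op scale W \<rho> \<alpha> H F"
    using assms tensor_space_off_vreg[OF F]
    by (auto simp: a_def s_def act_single refl_carrier families_def res_def nabla_op_def
        Let_def fun_act_def fun_eq_iff)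
  finally show "act (nabla H) F = nabla_op scale W \<rho> \<alpha> H F" .
qed

lemma fun_elt_closed: "f \<in> polyfuns scale \<Longrightarrow> fun_elt scale W \<rho> f \<in> \<T>"
  unfolding fun_elt_def by (intro single_closed regfuns_res) auto

lemma grp_elt_closed: "u \<in> carrier W \<Longrightarrow> grp_elt scale W \<rho> u \<in> \<T>"
  unfolding grp_elt_def by (intro single_closed regfuns_res polyfuns.const)

lemma poly_incl_apply:
  "poly_incl scale W \<rho> f w v = (if w \<in> carrier W \<and> v \<in> vreg scale W \<rho> then f v else 0)"
  by (simp add: poly_incl_def families_def res_def)

lemma act_fun_elt: "F \<in> \<T> \<Longrightarrow> act (fun_elt scale W \<rho> f) F = (\<lambda>w v. poly_incl scale W \<rho> f w v * F w v)"
  unfolding fun_elt_def poly_incl_def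
  by (auto simp: act_single families_def fun_eq_iff)

section \<open>The module of quasi-covariants\<close>

definition extend :: "('g \<Rightarrow> 'v \<Rightarrow> 'k) \<Rightarrow> 'g \<Rightarrow> 'v \<Rightarrow> 'k" where
  "extend p = families W (\<lambda>w. rst (p w))"

lemma extend_apply: "extend p w v = (if w \<in> carrier W \<and> v \<in> vreg scale W \<rho> then p w v else 0)"
  by (simp add: extend_def families_def res_def)

abbreviation "\<Q> \<equiv> quasi_covariants scale W \<rho> \<alpha>"

text \<open>Closure of \<open>\<Q> m\<close> under an operation is thereby reduced to polynomial
  representatives.\<close>

lemma quasi_covariants_eq: "\<Q> m = extend ` Collect (quasi_covariant_family m)"
  by (auto simp: quasi_covariants_def quasi_covariant_family_def extend_def)

lemma quasi_covariantsI: "quasi_covariant_family m p \<Longrightarrow> F = extend p \<Longrightarrow> F \<in> \<Q> m"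
  by (simp add: quasi_covariants_eq)

lemma quasi_covariantsE:
  assumes "F \<in> \<Q> m"
  obtains p where "quasi_covariant_family m p" "F = extend p"
  using assms by (auto simp: quasi_covariants_eq)

lemma quasi_covariants_subset: "\<Q> m \<subseteq> \<T>"
proof
  fix F assume "F \<in> \<Q> m"
  then obtain p where "quasi_covariant_family m p" "F = extend p"
    by (rule quasi_covariantsE)
  then show "F \<in> \<T>"
    by (auto simp: tensor_space_iff extend_def families_def
        intro!: regfuns_res quasi_covariant_family_polyfuns)
qed

lemma quasi_covariants_add:
  assumes "F \<in> \<Q> m" "G \<in> \<Q> m"
  shows "(\<lambda>w v. F w v + G w v) \<in> \<Q> m"
proof -
  obtain p q where "quasi_covariant_family m p" "F = extend p"
    "quasi_covariant_family m q" "G = extend q"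
    using assms by (elim quasi_covariantsE)
  then show ?thesis
    by (intro quasi_covariantsI[OF quasi_covariant_family_add[of m p q]])
      (auto simp: extend_apply fun_eq_iff)
qed

lemma quasi_covariants_mult:
  assumes "F \<in> \<Q> m" "G \<in> \<Q> m"
  shows "(\<lambda>w v. F w v * G w v) \<in> \<Q> m"
proof -
  obtain p q where "quasi_covariant_family m p" "F = extend p"
    "quasi_covariant_family m q" "G = extend q"
    using assms by (elim quasi_covariantsE)
  then show ?thesis
    by (intro quasi_covariantsI[OF quasi_covariant_family_mult[of m p q]])
      (auto simp: extend_apply fun_eq_iff)
qed

lemma poly_incl_closed: "f \<in> polyfuns scale \<Longrightarrow> poly_incl scale W \<rho> f \<in> \<Q> m"
  by (rule quasi_covariantsI[OF quasi_covariant_family_const]) (simp_all add: poly_incl_def extend_def)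

lemma quasi_covariants_uminus:
  assumes "F \<in> \<Q> m"
  shows "(\<lambda>w v. - F w v) \<in> \<Q> m"
proof -
  obtain p where "quasi_covariant_family m p" "F = extend p"
    using assms by (rule quasi_covariantsE)
  then show ?thesis
    by (intro quasi_covariantsI[OF quasi_covariant_family_uminus[of m p]])
      (auto simp: extend_apply fun_eq_iff)
qed

lemma act_grp_elt_quasi_covariants:
  assumes m: "m \<in> multiplicities scale W \<rho>" and u: "u \<in> carrier W" and F: "F \<in> \<Q> m"
  shows "act (grp_elt scale W \<rho> u) F \<in> \<Q> m"
proof -
  obtain p where p: "quasi_covariant_family m p" "F = extend p"
    using F by (rule quasi_covariantsE)
  show ?thesis
    by (rule quasi_covariantsI[OF quasi_covariant_family_translate[OF m u p(1)]])
      (use u in \<open>auto simp: p(2) grp_elt_def act_single extend_apply families_def res_def fun_eq_iff\<close>)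
qed

lemma nabla_op_quasi_covariants:
  assumes m: "m \<in> multiplicities scale W \<rho>" and H: "H \<in> \<A>" and odd: "odd (m H)" and F: "F \<in> \<Q> m"
  shows "nabla_op scale W \<rho> \<alpha> H F \<in> \<Q> m"
proof -
  obtain p where p: "quasi_covariant_family m p" "F = extend p"
    using F by (rule quasi_covariantsE)
  obtain g where g: "quasi_covariant_family m g"
    "\<And>w v. w \<in> carrier W \<Longrightarrow> p w v - p (\<sigma> H \<otimes>\<^bsub>W\<^esub> w) (\<rho> (\<sigma> H) v) = \<alpha> H v * g w v"
    using quasi_covariant_family_nabla[OF m H odd p(1)] by blast
  have "nabla_op scale W \<rho> \<alpha> H F = extend g"
  proof (intro ext)
    fix w v
    \<comment> \<open>Only on V_reg does the division have to be undone; elsewhere both families are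
      zero by convention.\<close>
    have "\<alpha> H v \<noteq> 0" if "v \<in> vreg scale W \<rho>"
      using that H by (simp add: vreg_iff)
    then show "nabla_op scale W \<rho> \<alpha> H F w v = extend g w v"
      using H by (simp add: nabla_op_def Let_def p(2) extend_apply families_def res_def fun_act_def
          refl_carrier g(2))
  qed
  with g(1) show ?thesis
    by (rule quasi_covariantsI)
qed

abbreviation "QM \<equiv> quasi_covariant_module scale W \<rho> \<alpha>"

lemma quasi_covariant_module_simps [simp]:
  "carrier (QM m) = \<Q> m" "monoid.mult (QM m) = (\<lambda>F G w v. F w v * G w v)"
  "one (QM m) = poly_incl scale W \<rho> (\<lambda>_. 1)" "ring.zero (QM m) = (\<lambda>_ _. 0)"
  "ring.add (QM m) = (\<lambda>F G w v. F w v + G w v)" "module.smult (QM m) = act"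
  by (simp_all add: quasi_covariant_module_def poly_incl_def)

lemma cring_quasi_covariant_module: "cring (QM m)"
proof (rule cringI)
  show "abelian_group (QM m)"
  proof (rule abelian_groupI)
    show "\<exists>y\<in>carrier (QM m). y \<oplus>\<^bsub>QM m\<^esub> x = \<zero>\<^bsub>QM m\<^esub>" if "x \<in> carrier (QM m)" for x
      using that by (intro bexI[of _ "\<lambda>w v. - x w v"]) (simp_all add: quasi_covariants_uminus)
    show "\<zero>\<^bsub>QM m\<^esub> \<in> carrier (QM m)"
      by (auto intro!: quasi_covariantsI[OF quasi_covariant_family_const[OF polyfuns.const[of 0]]]
          simp: extend_apply fun_eq_iff)
  qed (simp_all add: quasi_covariants_add ac_simps)
  \<comment> \<open>The unit is the indicator function of the carrier and V_reg, where every
    quasi-covariant is supported.\<close>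
  have one: "poly_incl scale W \<rho> (\<lambda>_. 1) w v * F w v = F w v" if "F \<in> \<Q> m" for F w v
    using subsetD[OF quasi_covariants_subset that] tensor_space_off_carrier tensor_space_off_vreg
    by (auto simp: poly_incl_apply)
  show "comm_monoid (QM m)"
  proof (rule comm_monoidI)
    show "\<one>\<^bsub>QM m\<^esub> \<otimes>\<^bsub>QM m\<^esub> F = F" if "F \<in> carrier (QM m)" for F
      using that by (simp add: one)
  qed (simp_all add: quasi_covariants_mult poly_incl_closed polyfuns.const ac_simps)
qed (simp add: distrib_right)

section \<open>The action of the Demazure algebra\<close>

abbreviation "DA \<equiv> demazure_algebra scale W \<rho> \<alpha>"

definition demazure_generators :: "('g \<Rightarrow> 'v \<Rightarrow> 'k) set" where
  "demazure_generators = fun_elt scale W \<rho> ` polyfuns scale \<union> grp_elt scale W \<rho> ` carrier W \<union> nabla ` \<A>"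

lemma demazure_algebra_eq: "DA = CP\<lparr>carrier := generate_ring CP demazure_generators\<rparr>"
  by (simp add: demazure_algebra_def demazure_generators_def)

lemma demazure_generators_subset: "demazure_generators \<subseteq> carrier CP"
  by (auto simp: demazure_generators_def fun_elt_closed grp_elt_closed nabla_elt_closed)

text \<open>Induction on the generation of \<open>A\<close> leaves only the three kinds of
  generators to check. \<open>F\<close> has to vary, because in a product the left factor acts on
  the result of the right one.\<close>

lemma act_demazure_quasi_covariants:
  assumes m: "m \<in> multiplicities scale W \<rho>" and odd: "\<And>H. H \<in> \<A> \<Longrightarrow> odd (m H)"
    and A: "A \<in> carrier DA" and F: "F \<in> \<Q> m"
  shows "act A F \<in> \<Q> m"
proof -
  have "A \<in> generate_ring CP demazure_generators"
    using A by (simp add: demazure_algebra_eq)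
  then show ?thesis
    using F
  proof (induction arbitrary: F)
    case one
    then show ?case
      using act_one_left[OF subsetD[OF quasi_covariants_subset]] by simp
  next
    case (incl A)
    have F: "F \<in> \<T>"
      using incl.prems quasi_covariants_subset by blast
    from incl.hyps consider f where "f \<in> polyfuns scale" "A = fun_elt scale W \<rho> f"
      | u where "u \<in> carrier W" "A = grp_elt scale W \<rho> u"
      | H where "H \<in> \<A>" "A = nabla H"
      by (auto simp: demazure_generators_def)
    then show ?case
    proof cases
      case 1
      then show ?thesis
        using quasi_covariants_mult[OF poly_incl_closed incl.prems] by (simp add: act_fun_elt[OF F])
    next
      case 2
      then show ?thesis
        using act_grp_elt_quasi_covariants[OF m _ incl.prems] by simp
    next
      case 3
      then show ?thesis
        using nabla_op_quasi_covariants[OF m _ odd incl.prems] by (simp add: act_nabla_elt F)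
    qed
  next
    case (a_inv A)
    then have "A \<in> \<T>"
      using CP.generate_ring_in_carrier[OF demazure_generators_subset] by simp
    then show ?case
      using a_inv by (simp add: a_inv_crossed_product act_uminus_left quasi_covariants_uminus)
  next
    case (eng_add A B)
    then show ?case
      by (simp add: act_add_left quasi_covariants_add)
  next
    case (eng_mult A B)
    then show ?case
      by (simp add: act_assoc)
  qed
qed

text \<open>The module laws are inherited from the action on the tensor space; the closure under
  scalar multiplication is the previous lemma.\<close>

lemma left_module_quasi_covariants:
  assumes m: "m \<in> multiplicities scale W \<rho>" and odd: "\<And>H. H \<in> \<A> \<Longrightarrow> odd (m H)"
  shows "left_module DA (QM m)"
proof -
  interpret DA: ring DA
    unfolding demazure_algebra_eq by (rule CP.generate_ring_is_ring[OF demazure_generators_subset])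
  interpret QM: cring "QM m"
    by (rule cring_quasi_covariant_module)
  have [simp]: "monoid.mult DA = act" "one DA = single \<one>\<^bsub>W\<^esub> (rst (\<lambda>_. 1))"
    "ring.add DA = (\<lambda>A B w v. A w v + B w v)"
    by (simp_all add: demazure_algebra_eq)
  show ?thesis
  proof unfold_locales
    show "A \<odot>\<^bsub>QM m\<^esub> F \<in> carrier (QM m)" if "A \<in> carrier DA" "F \<in> carrier (QM m)" for A F
      using act_demazure_quasi_covariants[OF m odd] that by simp
    show "\<one>\<^bsub>DA\<^esub> \<odot>\<^bsub>QM m\<^esub> F = F" if "F \<in> carrier (QM m)" for F
      using that quasi_covariants_subset act_one_left by auto
  qed (simp_all add: act_add_left act_add_right act_assoc)
qed

section \<open>The embedding of polynomial functions\<close>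

lemma poly_incl_ring_hom: "poly_incl scale W \<rho> \<in> ring_hom (polyfun_ring scale) (QM m)"
  by (rule ring_hom_memI)
    (auto simp: polyfun_ring_def poly_incl_closed poly_incl_apply fun_eq_iff)

lemma poly_incl_inj: "inj_on (poly_incl scale W \<rho>) (polyfuns scale)"
proof (rule inj_onI)
  fix f g assume fg: "f \<in> polyfuns scale" "g \<in> polyfuns scale"
    and "poly_incl scale W \<rho> f = poly_incl scale W \<rho> g"
  then have "poly_incl scale W \<rho> f \<one>\<^bsub>W\<^esub> = poly_incl scale W \<rho> g \<one>\<^bsub>W\<^esub>"
    by simp
  then have "rst f = rst g"
    by (simp add: poly_incl_def families_def)
  with fg show "f = g"
    by (rule res_polyfuns_inj)
qed

end

theorem theorem2p18:
  fixes scale :: "'k::field_char_0 \<Rightarrow> 'v::ab_group_add \<Rightarrow> 'v"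
    and Basis :: "'v set"
    and W :: "('g, 'c) monoid_scheme"
    and \<rho> :: "'g \<Rightarrow> 'v \<Rightarrow> 'v"
    and S :: "'g set"
    and \<alpha> :: "'v set \<Rightarrow> 'v \<Rightarrow> 'k"
    and k :: "'v set \<Rightarrow> nat"
  assumes "coxeter_reflection_rep scale Basis W \<rho> S"
    and "hyperplane_forms scale W \<rho> \<alpha>"
    and "k \<in> multiplicities scale W \<rho>"
  shows
    "let \<A> = arrangement scale W \<rho>;
         M = tensor_space scale W \<rho> \<alpha>;
         Q = quasi_covariant_module scale W \<rho> \<alpha> (\<lambda>H. 2 * k H + 1);
         N = demazure_algebra scale W \<rho> \<alpha>
     in carrier Q \<subseteq> M \<and>
        (\<forall>H \<in> \<A>. \<forall>F \<in> carrier Q. nabla_op scale W \<rho> \<alpha> H F \<in> carrier Q) \<and>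
        (\<forall>H \<in> \<A>. \<forall>F \<in> M.
           twisted_act W \<rho> (nabla_elt scale W \<rho> \<alpha> H) F = nabla_op scale W \<rho> \<alpha> H F) \<and>
        left_module N Q \<and>
        cring Q \<and>
        poly_incl scale W \<rho> \<in> ring_hom (polyfun_ring scale) Q \<and>
        inj_on (poly_incl scale W \<rho>) (carrier (polyfun_ring scale)) \<and>
        (\<forall>f \<in> carrier (polyfun_ring scale). \<forall>F \<in> carrier Q.
           fun_elt scale W \<rho> f \<odot>\<^bsub>Q\<^esub> F = poly_incl scale W \<rho> f \<otimes>\<^bsub>Q\<^esub> F)"
proof -
  interpret reflection_forms scale Basis W \<rho> S \<alpha>
    using assms(1,2) by (simp add: reflection_forms_def reflection_forms_axioms_def)
  have m: "(\<lambda>H. 2 * k H + 1) \<in> multiplicities scale W \<rho>"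
    using assms(3) by (simp add: multiplicities_def)
  show ?thesis
    unfolding Let_def
  proof (intro conjI ballI)
    show "left_module DA (QM (\<lambda>H. 2 * k H + 1))"
      by (rule left_module_quasi_covariants[OF m]) simp
    show "cring (QM (\<lambda>H. 2 * k H + 1))"
      by (rule cring_quasi_covariant_module)
    show "poly_incl scale W \<rho> \<in> ring_hom (polyfun_ring scale) (QM (\<lambda>H. 2 * k H + 1))"
      by (rule poly_incl_ring_hom)
    show "inj_on (poly_incl scale W \<rho>) (carrier (polyfun_ring scale))"
      using poly_incl_inj by (simp add: polyfun_ring_def)
    show "carrier (QM (\<lambda>H. 2 * k H + 1)) \<subseteq> \<T>"
      using quasi_covariants_subset by simp
    show "nabla_op scale W \<rho> \<alpha> H F \<in> carrier (QM (\<lambda>H. 2 * k H + 1))"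
      if "H \<in> \<A>" "F \<in> carrier (QM (\<lambda>H. 2 * k H + 1))" for H F
      using nabla_op_quasi_covariants[OF m that(1)] that(2) by simp
    show "fun_elt scale W \<rho> f \<odot>\<^bsub>QM (\<lambda>H. 2 * k H + 1)\<^esub> F
        = poly_incl scale W \<rho> f \<otimes>\<^bsub>QM (\<lambda>H. 2 * k H + 1)\<^esub> F"
      if "F \<in> carrier (QM (\<lambda>H. 2 * k H + 1))" for f F
      using that quasi_covariants_subset act_fun_elt by auto
  qed (rule act_nabla_elt)
qed

end
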